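(* Let $C(a,b)=a^4+22a^2b^2+125b^4$, $A(a,b)=(-3a^4-30a^2b^2-15b^4)C(a,b)$, $B(a,b)=2(a^4+4a^2b^2-b^4)(a^4+22a^2b^2+125b^4)C(a,b)$, and $H(a,b):=\max\{4|A(a,b)|^3,27|B(a,b)|^2\}$. For $X>0$ let $N_2(X)$ be the number of pairs $(a,b)\in\mathbb{Z}^2$ with $b>0$, $\gcd(a,b)=1$, $4A(a,b)^3+27B(a,b)^2\neq0$, no integer $m>1$ with $m^4\mid A(a,b)$ and $m^6\mid B(a,b)$, and $H(a,b)\le X$. Let $\mathcal{R}:=\{(u,v)\in\mathbb{R}^2: v>0,\ |A(u,v)|\le4^{-1/3},\ |B(u,v)|\le27^{-1/2}\}$; for a prime $\ell$ let $r_\ell$ be the number of solutions of $t^4+22t^2+125\equiv0$ in $\mathbb{Z}/\ell\mathbb{Z}$, and let \[\mathfrak{d}_\ell:=\ell^{-12}\,\#\{(a,b)\in(\mathbb{Z}/\ell^6\mathbb{Z})^2:\ (a,b)\not\equiv(0,0)\ (\mathrm{mod}\ \ell),\ \text{and }\big(A(a,b)\not\equiv0\ (\mathrm{mod}\ \ell^4)\text{ or }B(a,b)\not\equiv0\ (\mathrm{mod}\ \ell^6)\big)\}.\] Then \[N_2(X)\sim\mathfrak{d}_2\mathfrak{d}_3\mathfrak{d}_5\prod_{\ell\neq2,3,5}\Big(1-\frac{1}{\ell^2}-\frac{r_\ell(\ell-1)}{\ell^5}\Big)\operatorname{Area}(\mathcal{R})\,X^{1/12}\quad\text{as }X\to\infty.\]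 Moreover, the number of $\mathbb{Q}$-isomorphism classes of elliptic curves $E/\mathbb{Q}$ with naive height $\operatorname{ht}(E)\le X$ that have a $(2,5)$-entanglement of type $\mathbb{Z}/2\mathbb{Z}$ is $\gg X^{1/12}$.
   Context: Every elliptic curve $E/\mathbb{Q}$ has a unique globally minimal short model $y^2=x^3+Ax+B$ with $A,B\in\mathbb{Z}$ and no integer $m>1$ with $m^4\mid A$, $m^6\mid B$; its naive height is $\operatorname{ht}(E)=\max\{4|A|^3,27|B|^2\}$. For $n\ge1$, $\mathbb{Q}(E[n])$ denotes the $n$-division field. $E$ has a $(2,5)$-entanglement of type $\mathbb{Z}/2\mathbb{Z}$ if $K:=\mathbb{Q}(E[2])\cap\mathbb{Q}(E[5])\neq\mathbb{Q}$ and $\operatorname{Gal}(K/\mathbb{Q})\cong\mathbb{Z}/2\mathbb{Z}$. *)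

theory Defs
  imports
    "HOL-Analysis.Analysis"
    "HOL-Library.Landau_Symbols"
    "HOL-Algebra.Algebraic_Closure_Type"
    "HOL-Algebra.Generated_Fields"
    "HOL-Algebra.Elementary_Groups"
    "HOL-Algebra.Bij"
begin

section \<open>Elliptic curves over the rationals\<close>

text \<open>
  A pair \<open>(A, B)\<close> of rationals stands for the short Weierstrass curve
  \<open>y^2 = x^3 + A x + B\<close>.
\<close>

type_synonym weierstrass = "rat \<times> rat"

definition elliptic_curves :: "weierstrass set" where
  "elliptic_curves = {(A, B). 4 * A ^ 3 + 27 * B ^ 2 \<noteq> 0}"

text \<open>
  The isomorphisms over the rationals between two such curves are the maps
  \<open>(x, y) \<mapsto> (u^2 x, u^3 y)\<close> with \<open>u\<close> a nonzero rational.
\<close>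

definition ec_iso :: "(weierstrass \<times> weierstrass) set" where
  "ec_iso = {((A, B), (A', B')). (A, B) \<in> elliptic_curves \<and> (A', B') \<in> elliptic_curves \<and>
     (\<exists>u. u \<noteq> 0 \<and> A' = u ^ 4 * A \<and> B' = u ^ 6 * B)}"

definition minimal_pair :: "int \<Rightarrow> int \<Rightarrow> bool" where
  "minimal_pair A B \<longleftrightarrow> \<not> (\<exists>m>1. m ^ 4 dvd A \<and> m ^ 6 dvd B)"

definition minimal_model :: "weierstrass \<Rightarrow> int \<times> int" where
  "minimal_model E = (THE (A, B). minimal_pair A B \<and> (E, (of_int A, of_int B)) \<in> ec_iso)"

definition model_height :: "int \<Rightarrow> int \<Rightarrow> int" where
  "model_height A B = max (4 * \<bar>A\<bar> ^ 3) (27 * \<bar>B\<bar> ^ 2)"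

definition naive_height :: "weierstrass \<Rightarrow> int" where
  "naive_height E = (case minimal_model E of (A, B) \<Rightarrow> model_height A B)"


section \<open>Division fields and entanglement\<close>

type_synonym qbar = "rat alg_closure"

abbreviation qbar_ring :: "qbar ring" where
  "qbar_ring \<equiv> ring_of_type_algebra"

definition rationals :: "qbar set" where
  "rationals = range to_ac"

datatype ec_point = Infinity | Affine qbar qbar

text \<open>
  The chord-tangent law on \<open>y^2 = x^3 + A x + B\<close>; the formulas do not involve \<open>B\<close>.
  For points of the curve with \<open>x1 = x2\<close> and \<open>y1 \<noteq> - y2\<close>, the two points are equal and the
  chord is the tangent.
\<close>

fun ec_add :: "qbar \<Rightarrow> ec_point \<Rightarrow> ec_point \<Rightarrow> ec_point" where
  "ec_add A Infinity Q = Q"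
| "ec_add A P Infinity = P"
| "ec_add A (Affine x1 y1) (Affine x2 y2) =
     (if x1 = x2 \<and> y1 = - y2 then Infinity
      else let s = (if x1 = x2 then (3 * x1 ^ 2 + A) / (2 * y1) else (y2 - y1) / (x2 - x1));
               x3 = s ^ 2 - x1 - x2
           in Affine x3 (s * (x1 - x3) - y1))"

definition ec_points :: "weierstrass \<Rightarrow> ec_point set" where
  "ec_points E = insert Infinity
     {Affine x y | x y. y ^ 2 = x ^ 3 + to_ac (fst E) * x + to_ac (snd E)}"

definition ec_mult :: "weierstrass \<Rightarrow> nat \<Rightarrow> ec_point \<Rightarrow> ec_point" where
  "ec_mult E n P = ((ec_add (to_ac (fst E)) P) ^^ n) Infinity"

definition torsion :: "weierstrass \<Rightarrow> nat \<Rightarrow> ec_point set" where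
  "torsion E n = {P \<in> ec_points E. ec_mult E n P = Infinity}"

definition division_field :: "weierstrass \<Rightarrow> nat \<Rightarrow> qbar set" where
  "division_field E n =
     generate_field qbar_ring (\<Union>{{x, y} | x y. Affine x y \<in> torsion E n})"

text \<open>
  The group of automorphisms of \<open>K\<close> that fix \<open>F\<close> pointwise, for subfields
  \<open>F \<subseteq> K\<close>. It is used only for Galois extensions: an intersection of division
  fields is Galois over the rationals.
\<close>

definition galois_group :: "qbar set \<Rightarrow> qbar set \<Rightarrow> (qbar \<Rightarrow> qbar) monoid" where
  "galois_group K F = (BijGroup K)
     \<lparr>carrier := {\<sigma> \<in> Bij K.
        \<sigma> \<in> ring_hom (qbar_ring\<lparr>carrier := K\<rparr>) (qbar_ring\<lparr>carrier := K\<rparr>) \<and> (\<forall>x\<in>F. \<sigma> x = x)}\<rparr>"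

definition has_25_entanglement_Z2 :: "weierstrass \<Rightarrow> bool" where
  "has_25_entanglement_Z2 E \<longleftrightarrow>
     (let K = division_field E 2 \<inter> division_field E 5
      in K \<noteq> rationals \<and> galois_group K rationals \<cong> integer_mod_group 2)"

definition entangled_class_count :: "real \<Rightarrow> nat" where
  "entangled_class_count x =
     card ({E \<in> elliptic_curves. of_int (naive_height E) \<le> x \<and> has_25_entanglement_Z2 E} // ec_iso)"


section \<open>The two-parameter family\<close>

definition famC :: "'a::comm_ring_1 \<Rightarrow> 'a \<Rightarrow> 'a" where
  "famC a b = a ^ 4 + 22 * a ^ 2 * b ^ 2 + 125 * b ^ 4"

definition famA :: "'a::comm_ring_1 \<Rightarrow> 'a \<Rightarrow> 'a" where
  "famA a b = (- 3 * a ^ 4 - 30 * a ^ 2 * b ^ 2 - 15 * b ^ 4) * famC a b"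

definition famB :: "'a::comm_ring_1 \<Rightarrow> 'a \<Rightarrow> 'a" where
  "famB a b = 2 * (a ^ 4 + 4 * a ^ 2 * b ^ 2 - b ^ 4) *
     (a ^ 4 + 22 * a ^ 2 * b ^ 2 + 125 * b ^ 4) * famC a b"

definition N2 :: "real \<Rightarrow> nat" where
  "N2 x = card {(a :: int, b :: int). b > 0 \<and> gcd a b = 1 \<and>
     4 * famA a b ^ 3 + 27 * famB a b ^ 2 \<noteq> 0 \<and>
     minimal_pair (famA a b) (famB a b) \<and>
     of_int (model_height (famA a b) (famB a b)) \<le> x}"

definition region :: "(real \<times> real) set" where
  "region = {(u, v). v > 0 \<and> \<bar>famA u v\<bar> \<le> 4 powr (- 1 / 3) \<and> \<bar>famB u v\<bar> \<le> 27 powr (- 1 / 2)}"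

definition root_count :: "nat \<Rightarrow> nat" where
  "root_count l = card {t \<in> {0..<int l}. int l dvd t ^ 4 + 22 * t ^ 2 + 125}"

definition local_density :: "nat \<Rightarrow> real" where
  "local_density l =
     real (card {(a, b) \<in> {0..<int l ^ 6} \<times> {0..<int l ^ 6}.
        \<not> (int l dvd a \<and> int l dvd b) \<and>
        (\<not> int l ^ 4 dvd famA a b \<or> \<not> int l ^ 6 dvd famB a b)}) / real l ^ 12"

definition euler_factor :: "nat \<Rightarrow> real" where
  "euler_factor l = 1 - 1 / real l ^ 2 - real (root_count l) * (real l - 1) / real l ^ 5"

definition leading_constant :: real where
  "leading_constant =
     local_density 2 * local_density 3 * local_density 5 *
     (\<Prod>l. if Factorial_Ring.prime l \<and> l \<notin> {2, 3, 5} then euler_factor l else 1) *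
     measure lborel region"

end

theory Submission
  imports Defs "HOL-Number_Theory.Cong" "HOL-Real_Asymp.Real_Asymp"
begin

text \<open>
  Writing \<open>X = Y\<^sup>2\<^sup>4\<close>, the height condition says that \<open>(a / Y, b / Y)\<close> lies in the region. For a
  prime \<open>l\<close> other than 2, 3, 5 and \<open>(a, b)\<close> not divisible by \<open>l\<close>, the model is non-minimal at \<open>l\<close>
  exactly if \<open>l\<^sup>4\<close> divides \<open>famC a b\<close>. The conditions at the primes up to \<open>z\<close> are periodic, and the
  points satisfying them are counted by area. The points that fail at some prime above \<open>z\<close> number
  \<open>O(Y\<^sup>2 / z) + o(Y\<^sup>2)\<close>, because for large \<open>l\<close> each of the at most four root classes modulo \<open>l\<close> contains
  at most one primitive point. Letting \<open>z\<close> tend to infinity gives the asymptotics.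

  For the entangled curves, the quadratic twists of a single curve suffice. On
  \<open>y\<^sup>2 = x\<^sup>3 + d\<^sup>2 x\<close> the 2-division field is the field of Gaussian numbers. Any point with
  \<open>x\<^sup>2 = d\<^sup>2 (2 i - 1) / 5\<close> satisfies \<open>2 P = (- x, i y)\<close>, hence has order 5, so \<open>i\<close> lies in the
  5-division field as well. Squarefree \<open>d\<close> give pairwise non-isomorphic minimal models.
\<close>

section \<open>Lattice points in a region\<close>

text \<open>The exponent 24 comes from homogeneity: \<open>famA\<close> and \<open>famB\<close> have
  degrees 8 and 12, so both terms of the height have degree 24. The delicate range is that of the
  large primes. A value of \<open>famC\<close> can reach a constant times \<open>Y ^ 4\<close>, so
  primes up to about \<open>4 * Y\<close> have to be considered. Treating each line of fixed
  \<open>b\<close> separately costs about \<open>Y\<close> points per prime; with the trivial bound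
  for the number of primes this sums to the order of the main term. The determinant argument lowers
  the cost to a bounded one as soon as \<open>l\<close> exceeds a constant times the square root of
  \<open>Y\<close>. For the twists, \<open>(x, y) \<mapsto> (- x, i y)\<close> is the complex
  multiplication by \<open>i\<close>, so the equation for \<open>2 P\<close> says that
  \<open>P\<close> is killed by \<open>2 - i\<close>, a divisor of 5. The curve with parameter
  \<open>d\<close> has height \<open>4 * d ^ 6\<close>; this leaves \<open>X\<close> to the power
  1/6 for the range of \<open>d\<close>, and a crude bound for the number of squarefree integers is
  enough to reach 1/12.\<close>

lemma emeasure_lborel_Times:
  fixes A :: "real set" and B :: "real set"
  assumes "A \<in> sets borel" "B \<in> sets borel"
  shows "emeasure lborel (A \<times> B) = emeasure lborel A * emeasure lborel B"
  using assms unfolding lborel_prod [symmetric] by (intro lborel.emeasure_pair_measure_Times) auto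

lemma abs_grid_diff_le:
  fixes M c :: int and Y x :: real
  assumes "M > 0" "Y > 0"
  shows "\<bar>of_int (c + M * \<lfloor>x * Y / of_int M\<rfloor>) / Y - x\<bar> \<le> (\<bar>of_int c\<bar> + of_int M) / Y"
proof -
  define e where "e = x * Y / of_int M - of_int \<lfloor>x * Y / of_int M\<rfloor>"
  have e: "0 \<le> e" "e \<le> 1" unfolding e_def by linarith+
  have "of_int (c + M * \<lfloor>x * Y / of_int M\<rfloor>) / Y - x = (of_int c - of_int M * e) / Y"
    using assms by (simp add: e_def field_simps)
  also have "\<bar>\<dots>\<bar> \<le> (\<bar>of_int c\<bar> + of_int M * e) / Y"
    using assms e by (auto simp: abs_divide intro!: divide_right_mono order_trans[OF abs_triangle_ineq4])
  also have "\<dots> \<le> (\<bar>of_int c\<bar> + of_int M) / Y"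
    using assms e by (intro divide_right_mono add_left_mono) (auto intro: mult_left_le)
  finally show ?thesis .
qed

lemma tendsto_grid:
  fixes M c :: int
  assumes "M > 0"
  shows "((\<lambda>Y. of_int (c + M * \<lfloor>x * Y / of_int M\<rfloor>) / Y) \<longlongrightarrow> (x :: real)) at_top"
proof (rule Lim_transform[OF tendsto_const])
  show "((\<lambda>Y. of_int (c + M * \<lfloor>x * Y / of_int M\<rfloor>) / Y - x) \<longlongrightarrow> 0) at_top"
  proof (rule Lim_null_comparison)
    show "\<forall>\<^sub>F Y in at_top. norm (of_int (c + M * \<lfloor>x * Y / of_int M\<rfloor>) / Y - x) \<le> (\<bar>of_int c\<bar> + of_int M) / Y"
      using eventually_gt_at_top[of 0] by eventually_elim (use abs_grid_diff_le[OF assms] in auto)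
    show "((\<lambda>Y :: real. (\<bar>of_int c\<bar> + of_int M) / Y) \<longlongrightarrow> 0) at_top"
      by (intro tendsto_divide_0[OF tendsto_const] filterlim_at_top_imp_at_infinity filterlim_ident)
  qed
qed

lemma bounded_prod_obtain:
  fixes R :: "(real \<times> real) set"
  assumes "bounded R"
  obtains K where "\<And>x y. (x, y) \<in> R \<Longrightarrow> \<bar>x\<bar> \<le> K" "\<And>x y. (x, y) \<in> R \<Longrightarrow> \<bar>y\<bar> \<le> K"
proof -
  obtain K where "\<And>p. p \<in> R \<Longrightarrow> norm p \<le> K"
    using assms by (auto simp: bounded_iff)
  hence "\<bar>x\<bar> \<le> K \<and> \<bar>y\<bar> \<le> K" if "(x, y) \<in> R" for x y
    using that norm_fst_le[of x y] norm_snd_le[of y x] by (metis order_trans real_norm_def)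
  thus ?thesis using that by blast
qed

lemma finite_lattice_points:
  fixes R :: "(real \<times> real) set" and M c d :: int
  assumes "bounded R" "M > 0" "Y > 0"
  shows "finite {(i :: int, j :: int). (of_int (c + M * i) / Y, of_int (d + M * j) / Y) \<in> R}"
proof -
  obtain K where K: "\<And>x y. (x, y) \<in> R \<Longrightarrow> \<bar>x\<bar> \<le> K" "\<And>x y. (x, y) \<in> R \<Longrightarrow> \<bar>y\<bar> \<le> K"
    using bounded_prod_obtain[OF assms(1)] by metis
  have bound: "i \<in> {- (\<lceil>K * Y\<rceil> + \<bar>c\<bar>)..\<lceil>K * Y\<rceil> + \<bar>c\<bar>}" if "\<bar>of_int (c + M * i) / Y\<bar> \<le> K" for i c
  proof -
    have "\<bar>of_int (c + M * i)\<bar> \<le> K * Y" using that assms by (simp add: field_simps)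
    hence "\<bar>c + M * i\<bar> \<le> \<lceil>K * Y\<rceil>" by linarith
    moreover have "\<bar>i\<bar> \<le> \<bar>M * i\<bar>" using assms by (simp add: abs_mult mult_le_cancel_right1)
    ultimately have "\<bar>i\<bar> \<le> \<lceil>K * Y\<rceil> + \<bar>c\<bar>" by linarith
    thus ?thesis by auto
  qed
  have "{(i :: int, j :: int). (of_int (c + M * i) / Y, of_int (d + M * j) / Y) \<in> R}
    \<subseteq> {- (\<lceil>K * Y\<rceil> + \<bar>c\<bar>)..\<lceil>K * Y\<rceil> + \<bar>c\<bar>} \<times> {- (\<lceil>K * Y\<rceil> + \<bar>d\<bar>)..\<lceil>K * Y\<rceil> + \<bar>d\<bar>}"
    using K by (blast intro: bound)
  thus ?thesis by (rule finite_subset) auto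
qed

text \<open>
  Rounding to the lattice turns the count into the integral of a step function that converges to
  the indicator function of \<open>R\<close> off the frontier.
\<close>

lemma lattice_count_tendsto:
  fixes R :: "(real \<times> real) set" and M c d :: int
  assumes R: "bounded R" "R \<in> sets borel" "negligible (frontier R)" and M: "M > 0"
  shows "((\<lambda>Y. real (card {(i :: int, j :: int). (of_int (c + M * i) / Y, of_int (d + M * j) / Y) \<in> R}) / Y ^ 2)
    \<longlongrightarrow> measure lborel R / of_int M ^ 2) at_top"
proof -
  define g where "g = (\<lambda>Y p. (of_int (c + M * \<lfloor>fst p * Y / of_int M\<rfloor>) / Y :: real,
    of_int (d + M * \<lfloor>snd p * Y / of_int M\<rfloor>) / Y :: real))"
  define s where "s = (\<lambda>Y p. indicator R (g Y p) :: real)"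
  define J where "J = (\<lambda>Y. {(i :: int, j :: int). (of_int (c + M * i) / Y, of_int (d + M * j) / Y) \<in> R})"
  \<comment> \<open>The offset is kept out of the cells: a cell starts at \<open>M * i / Y\<close>,
    while the point attached to it is \<open>(c + M * i) / Y\<close>. The discrepancy vanishes as
    \<open>Y\<close> grows.\<close>
  define B where "B = (\<lambda>Y i. {of_int M / Y * of_int i..<of_int M / Y * (of_int i + 1) :: real})"
  obtain K where K: "\<And>x y. (x, y) \<in> R \<Longrightarrow> \<bar>x\<bar> \<le> K" "\<And>x y. (x, y) \<in> R \<Longrightarrow> \<bar>y\<bar> \<le> K"
    using bounded_prod_obtain[OF R(1)] by metis
  \<comment> \<open>For \<open>Y \<ge> 1\<close> rounding moves a coordinate by at most
    \<open>\<bar>c\<bar> + M\<close> or \<open>\<bar>d\<bar> + M\<close>, so all these step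
    functions vanish outside one fixed box, whose indicator \<open>w\<close> dominates them.\<close>
  define K' where "K' = K + \<bar>of_int c\<bar> + \<bar>of_int d\<bar> + of_int M"
  define w where "w = (\<lambda>p :: real \<times> real. indicator (cbox (- K', - K') (K', K')) p :: real)"
  have inB: "x \<in> B Y i \<longleftrightarrow> \<lfloor>x * Y / of_int M\<rfloor> = i" if "Y > 0" for x Y i
  proof -
    have "\<lfloor>x * Y / of_int M\<rfloor> = i \<longleftrightarrow> of_int i \<le> x * Y / of_int M \<and> x * Y / of_int M < of_int i + 1"
      by (simp add: floor_eq_iff)
    thus ?thesis using that M by (auto simp: B_def field_simps)
  qed
  have measB: "measure lborel (B Y i \<times> B Y j) = (of_int M / Y) ^ 2"
    "emeasure lborel (B Y i \<times> B Y j) < \<infinity>" if "Y > 0" for Y i j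
  proof -
    have "emeasure lborel (B Y i \<times> B Y j) = emeasure lborel (B Y i) * emeasure lborel (B Y j)"
      by (rule emeasure_lborel_Times) (auto simp: B_def)
    also have "\<dots> = ennreal ((of_int M / Y) ^ 2)"
      using that M by (simp add: B_def power2_eq_square field_simps flip: ennreal_mult)
    finally have "emeasure lborel (B Y i \<times> B Y j) = ennreal ((of_int M / Y) ^ 2)" .
    thus "measure lborel (B Y i \<times> B Y j) = (of_int M / Y) ^ 2"
      "emeasure lborel (B Y i \<times> B Y j) < \<infinity>"
      by (simp_all add: measure_def)
  qed
  have integral: "integral\<^sup>L lborel (s Y) = real (card (J Y)) * (of_int M / Y) ^ 2" if "Y > 0" for Y
  proof -
    have fin: "finite (J Y)" unfolding J_def using finite_lattice_points[OF R(1) M that] .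
    have "s Y p = (\<Sum>(i, j)\<in>J Y. indicator (B Y i \<times> B Y j) p)" for p
    proof -
      let ?q = "(\<lfloor>fst p * Y / of_int M\<rfloor>, \<lfloor>snd p * Y / of_int M\<rfloor>)"
      have "(\<Sum>(i, j)\<in>J Y. indicator (B Y i \<times> B Y j) p) = (\<Sum>q\<in>J Y. if q = ?q then 1 else 0 :: real)"
        by (intro sum.cong) (auto simp: indicator_def mem_Times_iff inB[OF that])
      also have "\<dots> = (if ?q \<in> J Y then 1 else 0)" using fin by simp
      also have "\<dots> = s Y p" by (simp add: s_def g_def J_def indicator_def)
      finally show ?thesis ..
    qed
    hence "integral\<^sup>L lborel (s Y) = integral\<^sup>L lborel (\<lambda>p. \<Sum>(i, j)\<in>J Y. indicator (B Y i \<times> B Y j) p)"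
      by presburger
    also have "\<dots> = (\<Sum>(i, j)\<in>J Y. integral\<^sup>L lborel (indicator (B Y i \<times> B Y j)))"
      unfolding split_def
      by (rule Bochner_Integration.integral_sum, rule integrable_real_indicator)
         (use measB[OF that] in \<open>auto simp: B_def lborel_prod [symmetric] intro!: pair_measureI\<close>)
    also have "\<dots> = (\<Sum>(i, j)\<in>J Y. (of_int M / Y) ^ 2)"
      by (intro sum.cong) (auto simp: measB[OF that])
    finally show ?thesis by (simp add: split_def)
  qed
  have "((\<lambda>Y. integral\<^sup>L lborel (s Y)) \<longlongrightarrow> integral\<^sup>L lborel (indicator R :: _ \<Rightarrow> real)) at_top"
  proof (rule integral_dominated_convergence_at_top)
    show "s Y \<in> borel_measurable lborel" for Y
    proof -
      have "g Y \<in> lborel \<Otimes>\<^sub>M lborel \<rightarrow>\<^sub>M borel \<Otimes>\<^sub>M borel"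
        unfolding g_def by measurable
      hence "g Y \<in> borel_measurable lborel"
        by (simp only: lborel_prod borel_prod)
      thus ?thesis unfolding s_def using R(2) by measurable
    qed
    show "(indicator R :: _ \<Rightarrow> real) \<in> borel_measurable lborel" using R(2) by simp
    show "integrable lborel w"
      unfolding w_def by (rule integrable_real_indicator) (simp, rule emeasure_lborel_cbox_finite)
    have "AE p in lebesgue. p \<notin> frontier R"
      using R(3) by (simp add: negligible_iff_null_sets AE_not_in)
    hence "AE p in lborel. p \<notin> frontier R"
      by (simp add: AE_completion_iff)
    thus "AE p in lborel. ((\<lambda>Y. s Y p) \<longlongrightarrow> indicator R p) at_top"
    proof (rule AE_mp, intro AE_I2 impI)
      fix p :: "real \<times> real" assume p: "p \<notin> frontier R"
      have "((\<lambda>Y. g Y p) \<longlongrightarrow> (fst p, snd p)) at_top"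
        unfolding g_def by (intro tendsto_Pair tendsto_grid M)
      hence g: "((\<lambda>Y. g Y p) \<longlongrightarrow> p) at_top" by simp
      have "\<forall>\<^sub>F Y in at_top. s Y p = indicator R p"
      proof (cases "p \<in> interior R")
        case True
        have "\<forall>\<^sub>F Y in at_top. g Y p \<in> interior R"
          using topological_tendstoD[OF g open_interior True] .
        thus ?thesis
          by eventually_elim (use True interior_subset in \<open>auto simp: s_def indicator_def\<close>)
      next
        case False
        hence out: "p \<in> - closure R" using p by (simp add: frontier_def)
        have "\<forall>\<^sub>F Y in at_top. g Y p \<in> - closure R"
          using topological_tendstoD[OF g open_Compl[OF closed_closure] out] .
        thus ?thesis
          by eventually_elim (use out closure_subset in \<open>auto simp: s_def indicator_def\<close>)
      qed
      thus "((\<lambda>Y. s Y p) \<longlongrightarrow> indicator R p) at_top"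
        by (rule tendsto_eventually)
    qed
    show "\<forall>\<^sub>F Y in at_top. AE p in lborel. norm (s Y p) \<le> w p"
      using eventually_ge_at_top[of 1]
    proof eventually_elim
      case (elim Y)
      show ?case
      proof (intro AE_I2)
        fix p :: "real \<times> real"
        show "norm (s Y p) \<le> w p"
        proof (cases "g Y p \<in> R")
          case True
          have abs_le: "\<bar>x\<bar> \<le> K + \<bar>of_int c\<bar> + of_int M"
            if "\<bar>of_int (c + M * \<lfloor>x * Y / of_int M\<rfloor>) / Y\<bar> \<le> K" for x and c :: int
          proof -
            have "(\<bar>of_int c\<bar> + of_int M) / Y \<le> \<bar>of_int c\<bar> + of_int M"
              using elim M by (simp add: divide_le_eq mult_le_cancel_left1)
            thus ?thesis using abs_grid_diff_le[OF M less_le_trans[OF zero_less_one elim], of c x] that by linarith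
          qed
          have bound: "\<bar>fst (g Y p)\<bar> \<le> K" "\<bar>snd (g Y p)\<bar> \<le> K"
            using True K[of "fst (g Y p)" "snd (g Y p)"] by auto
          have "\<bar>fst p\<bar> \<le> K + \<bar>of_int c\<bar> + of_int M" "\<bar>snd p\<bar> \<le> K + \<bar>of_int d\<bar> + of_int M"
            by (rule abs_le[OF bound(1)[unfolded g_def fst_conv]] abs_le[OF bound(2)[unfolded g_def snd_conv]])+
          hence "\<bar>fst p\<bar> \<le> K'" "\<bar>snd p\<bar> \<le> K'" by (simp_all add: K'_def)
          hence "p \<in> cbox (- K', - K') (K', K')"
            by (cases p) (auto simp: cbox_Pair_eq abs_le_iff)
          thus ?thesis by (simp add: s_def w_def indicator_def)
        qed (simp add: s_def w_def)
      qed
    qed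
  qed
  hence "((\<lambda>Y. integral\<^sup>L lborel (s Y) / of_int M ^ 2) \<longlongrightarrow> measure lborel R / of_int M ^ 2) at_top"
    using M R(2) by (intro tendsto_divide tendsto_const) auto
  moreover have "\<forall>\<^sub>F Y in at_top. integral\<^sup>L lborel (s Y) / of_int M ^ 2 = real (card (J Y)) / Y ^ 2"
    using eventually_gt_at_top[of 0]
    by eventually_elim (use M in \<open>simp add: integral power_divide\<close>)
  ultimately have "((\<lambda>Y. real (card (J Y)) / Y ^ 2) \<longlongrightarrow> measure lborel R / of_int M ^ 2) at_top"
    by (rule Lim_transform_eventually)
  thus ?thesis by (simp add: J_def)
qed

section \<open>Periodic conditions on lattice points\<close>

definition residue_count :: "int \<Rightarrow> (int \<Rightarrow> int \<Rightarrow> bool) \<Rightarrow> nat" where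
  "residue_count M P = card {(a, b) \<in> {0..<M} \<times> {0..<M}. P a b}"

definition periodic :: "int \<Rightarrow> (int \<Rightarrow> int \<Rightarrow> bool) \<Rightarrow> bool" where
  "periodic M P \<longleftrightarrow> (\<forall>a b. P a b \<longleftrightarrow> P (a mod M) (b mod M))"

text \<open>A periodic condition selects finitely many translates of the lattice of multiples of
  \<open>M\<close>. Each has the same density whatever its offset, so only their number enters the
  limit.\<close>

lemma periodic_count_tendsto:
  fixes R :: "(real \<times> real) set" and M :: int
  assumes R: "bounded R" "R \<in> sets borel" "negligible (frontier R)" and M: "M > 0"
    and P: "periodic M P"
  shows "((\<lambda>Y. real (card {(a, b). P a b \<and> (of_int a / Y, of_int b / Y) \<in> R}) / Y ^ 2)
    \<longlongrightarrow> real (residue_count M P) / of_int M ^ 2 * measure lborel R) at_top"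
proof -
  define S where "S = {(a, b) \<in> {0..<M} \<times> {0..<M}. P a b}"
  define J where "J = (\<lambda>Y (c, d). {(i :: int, j :: int). (of_int (c + M * i) / Y, of_int (d + M * j) / Y) \<in> R})"
  define f where "f = (\<lambda>((c, d), (i, j)). (c + M * i, d + M * j))"
  have fin: "finite S" unfolding S_def by (rule finite_subset[of _ "{0..<M} \<times> {0..<M}"]) auto
  have eq: "real (card {(a, b). P a b \<and> (of_int a / Y, of_int b / Y) \<in> R}) = (\<Sum>q\<in>S. real (card (J Y q)))"
    if "Y > 0" for Y
  proof -
    have forward: "P (c + M * i) (d + M * j) \<and> (of_int (c + M * i) / Y, of_int (d + M * j) / Y) \<in> R"
      if "(c, d) \<in> S" "(i, j) \<in> J Y (c, d)" for c d i j
    proof -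
      have "(c + M * i) mod M = c" "(d + M * j) mod M = d" using that M by (auto simp: S_def)
      hence "P (c + M * i) (d + M * j) \<longleftrightarrow> P c d" using P unfolding periodic_def by metis
      thus ?thesis using that by (simp add: J_def S_def)
    qed
    have backward: "(a mod M, b mod M) \<in> S \<and> (a div M, b div M) \<in> J Y (a mod M, b mod M)"
      if "P a b" "(of_int a / Y, of_int b / Y) \<in> R" for a b
    proof -
      have "P (a mod M) (b mod M)" using that P unfolding periodic_def by metis
      thus ?thesis using that M by (simp add: S_def J_def del: of_int_add of_int_mult)
    qed
    have "bij_betw f (SIGMA q:S. J Y q) {(a, b). P a b \<and> (of_int a / Y, of_int b / Y) \<in> R}"
    proof (rule bij_betwI[of _ _ _ "\<lambda>(a, b). ((a mod M, b mod M), (a div M, b div M))"])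
      show "f \<in> (SIGMA q:S. J Y q) \<rightarrow> {(a, b). P a b \<and> (of_int a / Y, of_int b / Y) \<in> R}"
        using forward by (fastforce simp: f_def)
      show "(\<lambda>(a, b). ((a mod M, b mod M), (a div M, b div M)))
          \<in> {(a, b). P a b \<and> (of_int a / Y, of_int b / Y) \<in> R} \<rightarrow> (SIGMA q:S. J Y q)"
        using backward by fastforce
      fix q assume "q \<in> (SIGMA q:S. J Y q)"
      then obtain c d i j where "q = ((c, d), (i, j))" "0 \<le> c" "c < M" "0 \<le> d" "d < M"
        by (auto simp: S_def)
      thus "(\<lambda>(a, b). ((a mod M, b mod M), (a div M, b div M))) (f q) = q"
        by (simp add: f_def)
    qed (auto simp: f_def)
    hence "card {(a, b). P a b \<and> (of_int a / Y, of_int b / Y) \<in> R} = card (SIGMA q:S. J Y q)"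
      by (rule bij_betw_same_card [THEN sym])
    also have "\<dots> = (\<Sum>q\<in>S. card (J Y q))"
      using fin finite_lattice_points[OF R(1) M that] by (subst card_SigmaI) (auto simp: J_def)
    finally show ?thesis by simp
  qed
  have "((\<lambda>Y. \<Sum>q\<in>S. real (card (J Y q)) / Y ^ 2) \<longlongrightarrow> (\<Sum>q\<in>S. measure lborel R / of_int M ^ 2)) at_top"
  proof (rule tendsto_sum)
    fix q :: "int \<times> int"
    obtain c d where q: "q = (c, d)" by (cases q)
    show "((\<lambda>Y. real (card (J Y q)) / Y ^ 2) \<longlongrightarrow> measure lborel R / of_int M ^ 2) at_top"
      unfolding q J_def prod.case by (rule lattice_count_tendsto[OF R M])
  qed
  moreover have "\<forall>\<^sub>F Y in at_top. (\<Sum>q\<in>S. real (card (J Y q)) / Y ^ 2) =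
      real (card {(a, b). P a b \<and> (of_int a / Y, of_int b / Y) \<in> R}) / Y ^ 2"
    using eventually_gt_at_top[of 0]
    by eventually_elim (simp only: eq sum_divide_distrib)
  moreover have "(\<Sum>q\<in>S. measure lborel R / of_int M ^ 2) = real (residue_count M P) / of_int M ^ 2 * measure lborel R"
    by (simp add: residue_count_def S_def)
  ultimately show ?thesis
    using Lim_transform_eventually by force
qed

section \<open>Local conditions\<close>

lemma periodic_dvd:
  assumes "periodic M P" "M dvd M'"
  shows "periodic M' P"
  unfolding periodic_def
proof (intro allI)
  fix a b
  have "P a b \<longleftrightarrow> P (a mod M) (b mod M)" "P (a mod M') (b mod M') \<longleftrightarrow> P (a mod M' mod M) (b mod M' mod M)"
    using assms(1) unfolding periodic_def by metis+
  thus "P a b \<longleftrightarrow> P (a mod M') (b mod M')"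
    using assms(2) by (simp add: mod_mod_cancel)
qed

text \<open>Chinese remainder theorem in both coordinates; periodicity lets \<open>P\<close> and
  \<open>Q\<close> be read off from the residues modulo \<open>m\<close> and \<open>n\<close>
  separately.\<close>

lemma residue_count_mult:
  assumes "coprime m n" "m > 0" "n > 0" "periodic m P" "periodic n Q"
  shows "residue_count (m * n) (\<lambda>a b. P a b \<and> Q a b) = residue_count m P * residue_count n Q"
proof -
  define S where "S = (\<lambda>m P. {(a, b) \<in> {0..<m} \<times> {0..<m :: int}. P a b})"
  define f where "f = (\<lambda>(a, b). ((a mod m, b mod m), (a mod n, b mod n)))"
  have P: "P a b \<longleftrightarrow> P (a mod m) (b mod m)" and Q: "Q a b \<longleftrightarrow> Q (a mod n) (b mod n)" for a b
    using assms(4,5) unfolding periodic_def by metis+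
  have "bij_betw f (S (m * n) (\<lambda>a b. P a b \<and> Q a b)) (S m P \<times> S n Q)"
  proof (rule bij_betw_imageI)
    have eqI: "a = a'" if "a mod m = a' mod m" "a mod n = a' mod n" "a \<in> {0..<m * n}" "a' \<in> {0..<m * n}" for a a'
    proof -
      have "[a = a'] (mod m * n)"
        using that assms(1) by (intro coprime_cong_mult) (auto simp: cong_def)
      thus ?thesis using that by (simp add: cong_def)
    qed
    show "inj_on f (S (m * n) (\<lambda>a b. P a b \<and> Q a b))"
    proof (rule inj_onI, clarify)
      fix a b a' b'
      assume h: "(a, b) \<in> S (m * n) (\<lambda>a b. P a b \<and> Q a b)" "(a', b') \<in> S (m * n) (\<lambda>a b. P a b \<and> Q a b)"
        "f (a, b) = f (a', b')"
      have "a mod m = a' mod m" "a mod n = a' mod n" "b mod m = b' mod m" "b mod n = b' mod n"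
        "a \<in> {0..<m * n}" "a' \<in> {0..<m * n}" "b \<in> {0..<m * n}" "b' \<in> {0..<m * n}"
        using h by (simp_all add: f_def S_def)
      thus "a = a' \<and> b = b'" by (blast intro: eqI)
    qed
    show "f ` S (m * n) (\<lambda>a b. P a b \<and> Q a b) = S m P \<times> S n Q"
    proof (intro equalityI subsetI)
      fix q assume "q \<in> f ` S (m * n) (\<lambda>a b. P a b \<and> Q a b)"
      then obtain a b where "q = ((a mod m, b mod m), (a mod n, b mod n))" "P a b" "Q a b"
        by (auto simp: f_def S_def)
      thus "q \<in> S m P \<times> S n Q"
        using P[of a b] Q[of a b] assms(2,3) by (simp add: S_def)
    next
      fix q assume "q \<in> S m P \<times> S n Q"
      then obtain a b c d where q: "q = ((a, b), (c, d))" "(a, b) \<in> S m P" "(c, d) \<in> S n Q"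
        by auto
      have crt: "\<exists>x \<in> {0..<m * n}. x mod m = u \<and> x mod n = v" if "u \<in> {0..<m}" "v \<in> {0..<n}" for u v
      proof -
        obtain x where "[x = u] (mod m)" "[x = v] (mod n)"
          using binary_chinese_remainder_int[OF assms(1)] by blast
        thus ?thesis using that assms(2,3)
          by (intro bexI[of _ "x mod (m * n)"]) (auto simp: cong_def mod_mod_cancel)
      qed
      obtain x y where xy: "x \<in> {0..<m * n}" "x mod m = a" "x mod n = c" "y \<in> {0..<m * n}" "y mod m = b" "y mod n = d"
        using crt[of a c] crt[of b d] q by (auto simp: S_def)
      have "(x, y) \<in> S (m * n) (\<lambda>a b. P a b \<and> Q a b)"
        using xy q P[of x y] Q[of x y] by (simp add: S_def)
      moreover have "f (x, y) = q" by (simp add: f_def xy q)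
      ultimately show "q \<in> f ` S (m * n) (\<lambda>a b. P a b \<and> Q a b)" by blast
    qed
  qed
  hence "card (S (m * n) (\<lambda>a b. P a b \<and> Q a b)) = card (S m P \<times> S n Q)"
    by (rule bij_betw_same_card)
  thus ?thesis by (simp add: S_def residue_count_def card_cartesian_product)
qed

text \<open>The condition counted by \<open>local_density\<close>, for integers instead of residues:
  primitive at \<open>l\<close> and minimal at \<open>l\<close>. It is decided modulo
  \<open>l ^ 6\<close>.\<close>

definition good :: "int \<Rightarrow> int \<Rightarrow> int \<Rightarrow> bool" where
  "good l a b \<longleftrightarrow> \<not> (l dvd a \<and> l dvd b) \<and> (\<not> l ^ 4 dvd famA a b \<or> \<not> l ^ 6 dvd famB a b)"

lemma local_density_eq: "local_density l = real (residue_count (int l ^ 6) (good (int l))) / real l ^ 12"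
  by (simp add: local_density_def residue_count_def good_def)

lemma cong_fam:
  fixes a b a' b' m :: int
  assumes "[a = a'] (mod m)" "[b = b'] (mod m)"
  shows "[famC a b = famC a' b'] (mod m)" "[famA a b = famA a' b'] (mod m)" "[famB a b = famB a' b'] (mod m)"
  unfolding famA_def famB_def famC_def
  by (intro cong_add cong_mult cong_pow cong_diff cong_refl assms)+

lemma periodic_good: "periodic (l ^ 6) (good l)"
  unfolding periodic_def
proof (intro allI)
  fix a b :: int
  let ?a = "a mod l ^ 6" and ?b = "b mod l ^ 6"
  have cong: "[x = x mod l ^ 6] (mod l ^ k)" if "k \<le> 6" for x k
    using le_imp_power_dvd[OF that, of l] by (simp add: cong_def mod_mod_cancel)
  have "l dvd a \<longleftrightarrow> l dvd ?a" "l dvd b \<longleftrightarrow> l dvd ?b"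
    using cong_dvd_iff[OF cong[of 1]] by auto
  moreover have "l ^ 4 dvd famA a b \<longleftrightarrow> l ^ 4 dvd famA ?a ?b"
    by (intro cong_dvd_iff cong_fam cong) auto
  moreover have "l ^ 6 dvd famB a b \<longleftrightarrow> l ^ 6 dvd famB ?a ?b"
    by (intro cong_dvd_iff cong_fam cong) auto
  ultimately show "good l a b \<longleftrightarrow> good l ?a ?b" by (simp add: good_def)
qed

lemma residue_count_good_primes:
  assumes "finite L" "\<And>l. l \<in> L \<Longrightarrow> Factorial_Ring.prime l"
  shows "periodic (\<Prod>l\<in>L. int l ^ 6) (\<lambda>a b. \<forall>l\<in>L. good (int l) a b) \<and>
    residue_count (\<Prod>l\<in>L. int l ^ 6) (\<lambda>a b. \<forall>l\<in>L. good (int l) a b) =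
      (\<Prod>l\<in>L. residue_count (int l ^ 6) (good (int l)))"
  using assms
proof (induction L rule: finite_induct)
  case empty
  have "{0..<1 :: int} = {0}" by auto
  thus ?case by (simp add: residue_count_def periodic_def)
next
  case (insert l L)
  let ?M = "\<Prod>l\<in>L. int l ^ 6"
  have IH: "periodic ?M (\<lambda>a b. \<forall>l\<in>L. good (int l) a b)"
    "residue_count ?M (\<lambda>a b. \<forall>l\<in>L. good (int l) a b) = (\<Prod>l\<in>L. residue_count (int l ^ 6) (good (int l)))"
    using insert by auto
  have pos: "?M > 0" "int l ^ 6 > 0"
    using insert.prems by (auto intro!: prod_pos simp: prime_gt_0_nat)
  have "coprime (int l ^ 6) ?M"
  proof (rule prod_coprime_right)
    fix k assume "k \<in> L"
    hence "coprime l k" using insert by (intro primes_coprime) auto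
    thus "coprime (int l ^ 6) (int k ^ 6)" by simp
  qed
  note count = residue_count_mult[OF this pos(2,1) periodic_good IH(1)]
  have "periodic (int l ^ 6 * ?M) (good (int l))"
    "periodic (int l ^ 6 * ?M) (\<lambda>a b. \<forall>l\<in>L. good (int l) a b)"
    by (rule periodic_dvd[OF periodic_good] periodic_dvd[OF IH(1)]; simp)+
  hence "periodic (int l ^ 6 * ?M) (\<lambda>a b. good (int l) a b \<and> (\<forall>l\<in>L. good (int l) a b))"
    unfolding periodic_def by metis
  thus ?case using insert.hyps count IH(2) by simp
qed

section \<open>Identities and common divisors in the family\<close>

lemma fam_factors:
  fixes a b :: "'a :: comm_ring_1"
  shows "famA a b = - 3 * (a ^ 4 + 10 * a ^ 2 * b ^ 2 + 5 * b ^ 4) * famC a b"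
    "famB a b = 2 * (a ^ 4 + 4 * a ^ 2 * b ^ 2 - b ^ 4) * famC a b ^ 2"
  by (simp_all add: famA_def famB_def famC_def power2_eq_square algebra_simps)

text \<open>
  With \<open>s = a\<^sup>2 / b\<^sup>2\<close> this is the formula for \<open>j - 1728\<close> on the modular curve \<open>X\<^sub>0(5)\<close>.
\<close>

lemma fam_identity:
  fixes a b :: "'a :: comm_ring_1"
  shows "(a ^ 4 + 10 * a ^ 2 * b ^ 2 + 5 * b ^ 4) ^ 3 - (a ^ 4 + 4 * a ^ 2 * b ^ 2 - b ^ 4) ^ 2 * famC a b
    = 1728 * a ^ 2 * b ^ 10"
proof -
  have "(p * p + 10 * p * q + 5 * (q * q)) ^ 3 - (p * p + 4 * p * q - q * q) ^ 2 * (p * p + 22 * p * q + 125 * (q * q))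
    = 1728 * p * q ^ 5" for p q :: 'a
    by (simp add: algebra_simps power2_eq_square power3_eq_cube eval_nat_numeral)
  from this[of "a ^ 2" "b ^ 2"] show ?thesis
    by (simp add: famC_def flip: power_add power_mult)
qed

text \<open>The constant is \<open>108 * 1728\<close>. Over the integers \<open>famC a b\<close> is
  positive for \<open>b > 0\<close>, so the singular members with \<open>b > 0\<close> are exactly
  those with \<open>a = 0\<close>.\<close>

lemma fam_discriminant:
  fixes a b :: "'a :: comm_ring_1"
  shows "4 * famA a b ^ 3 + 27 * famB a b ^ 2 = - (186624 * a ^ 2 * b ^ 10 * famC a b ^ 3)"
proof -
  have *: "4 * (- 3 * u * c) ^ 3 + 27 * (2 * v * c ^ 2) ^ 2 = - (108 * (u ^ 3 - v ^ 2 * c) * c ^ 3)" for u v c :: 'a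
    by (simp add: algebra_simps power2_eq_square power3_eq_cube)
  show ?thesis unfolding fam_factors * fam_identity by (simp add: algebra_simps)
qed

text \<open>The outer coefficients are 1 and a power of 5, so modulo \<open>l \<noteq> 5\<close>
  such a form has no zero on a coordinate axis except the origin. It serves for \<open>famC\<close>
  (\<open>c = 22\<close>, \<open>k = 3\<close>) and for the quartic factor of \<open>famA\<close>
  (\<open>c = 10\<close>, \<open>k = 1\<close>).\<close>

lemma prime_dvd_both:
  fixes l a b :: int
  assumes "Factorial_Ring.prime l" "l \<noteq> 5" "l dvd a ^ 4 + c * a ^ 2 * b ^ 2 + 5 ^ k * b ^ 4" "l dvd a \<or> l dvd b"
  shows "l dvd a \<and> l dvd b"
proof -
  have "\<not> l dvd 5 ^ k"
    using assms(1,2) prime_dvd_power[of l 5 k] by (auto simp: primes_dvd_imp_eq)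
  have "l dvd b" if "l dvd a"
  proof -
    have "l dvd (a ^ 4 + c * a ^ 2 * b ^ 2 + 5 ^ k * b ^ 4) - a * (a ^ 3 + c * a * b ^ 2)"
      by (intro dvd_diff assms(3) dvd_mult2 that)
    also have "\<dots> = 5 ^ k * b ^ 4" by (simp add: algebra_simps power2_eq_square eval_nat_numeral)
    finally have "l dvd b ^ 4" using assms(1) \<open>\<not> l dvd 5 ^ k\<close> by (simp add: prime_dvd_mult_iff)
    thus ?thesis using assms(1) prime_dvd_power by blast
  qed
  moreover have "l dvd a" if "l dvd b"
  proof -
    have "l dvd (a ^ 4 + c * a ^ 2 * b ^ 2 + 5 ^ k * b ^ 4) - b * (c * a ^ 2 * b + 5 ^ k * b ^ 3)"
      by (intro dvd_diff assms(3) dvd_mult2 that)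
    also have "\<dots> = a ^ 4" by (simp add: algebra_simps power2_eq_square eval_nat_numeral)
    finally show ?thesis using assms(1) prime_dvd_power by blast
  qed
  ultimately show ?thesis using assms(4) by blast
qed

lemma prime_dvd_famC:
  fixes l a b :: int
  assumes "Factorial_Ring.prime l" "l \<noteq> 5" "l dvd famC a b" "l dvd a \<or> l dvd b"
  shows "l dvd a \<and> l dvd b"
  using prime_dvd_both[of l a 22 b 3] assms by (simp add: famC_def)

text \<open>Suppose that \<open>(a, b)\<close> is primitive at \<open>l\<close>. By
  \<open>fam_identity\<close>, a prime dividing \<open>A0\<close> together with \<open>B0\<close> or
  \<open>famC a b\<close> would divide \<open>1728 * a ^ 2 * b ^ 10\<close> and then both
  coordinates. So if \<open>l\<close> divides \<open>famA\<close> and \<open>famB\<close>, it is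
  prime to \<open>A0\<close>, and the whole power of \<open>l\<close> in \<open>famA\<close> sits in
  \<open>famC\<close>. Conversely \<open>famC\<close> enters \<open>famB\<close> squared, so
  \<open>l ^ 4\<close> in \<open>famC\<close> gives even \<open>l ^ 8\<close> there.\<close>

lemma good_iff:
  fixes l a b :: int
  assumes l: "Factorial_Ring.prime l" "l \<notin> {2, 3, 5}"
  shows "good l a b \<longleftrightarrow> \<not> (l dvd a \<and> l dvd b) \<and> \<not> l ^ 4 dvd famC a b"
proof -
  \<comment> \<open>The coefficient 5 is written as \<open>5 ^ 1\<close> to fit
    \<open>prime_dvd_both\<close>.\<close>
  define A0 where "A0 = a ^ 4 + 10 * a ^ 2 * b ^ 2 + 5 ^ 1 * b ^ 4"
  define B0 where "B0 = a ^ 4 + 4 * a ^ 2 * b ^ 2 - b ^ 4"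
  have A: "famA a b = - 3 * A0 * famC a b" and B: "famB a b = 2 * B0 * famC a b ^ 2"
    by (simp_all add: fam_factors A0_def B0_def)
  have identity: "A0 ^ 3 - B0 ^ 2 * famC a b = 1728 * a ^ 2 * b ^ 10"
    using fam_identity[of a b] by (simp add: A0_def B0_def)
  have dvd_2_3: "\<not> l dvd 2" "\<not> l dvd 3"
    using l by (auto simp: primes_dvd_imp_eq)
  have "\<not> l dvd 2 ^ 6 * 3 ^ 3"
    using dvd_2_3 prime_dvd_power[OF l(1)] prime_dvd_mult_iff[OF l(1)] by blast
  hence dvd_1728: "\<not> l dvd 1728" by simp
  have both: "l dvd a \<and> l dvd b" if "l dvd A0" "l dvd B0 \<or> l dvd famC a b"
  proof -
    have "l dvd A0 ^ 3 - B0 ^ 2 * famC a b"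
      using that by (intro dvd_diff) (auto simp: power2_eq_square power3_eq_cube)
    hence "l dvd a \<or> l dvd b"
      unfolding identity using l(1) dvd_1728 by (auto simp: prime_dvd_mult_iff dest: prime_dvd_power)
    thus ?thesis using prime_dvd_both[of l a 10 b 1] l that(1) by (simp add: A0_def)
  qed
  have "l ^ 4 dvd famA a b \<and> l ^ 6 dvd famB a b \<longleftrightarrow> l ^ 4 dvd famC a b" if nb: "\<not> (l dvd a \<and> l dvd b)"
  proof
    assume C: "l ^ 4 dvd famC a b"
    have "l ^ 6 dvd (l ^ 4) ^ 2" by (simp add: le_imp_power_dvd flip: power_mult)
    also have "\<dots> dvd famC a b ^ 2" using C by (rule dvd_power_same)
    finally show "l ^ 4 dvd famA a b \<and> l ^ 6 dvd famB a b"
      using C by (simp add: A B)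
  next
    assume h: "l ^ 4 dvd famA a b \<and> l ^ 6 dvd famB a b"
    have AB: "l dvd famA a b" "l dvd famB a b"
      using h dvd_trans[of l "l ^ 4"] dvd_trans[of l "l ^ 6"] by (auto simp: dvd_power)
    have "\<not> l dvd A0"
    proof
      assume A0: "l dvd A0"
      hence nB: "\<not> l dvd B0" "\<not> l dvd famC a b" using both nb by auto
      hence "\<not> l dvd famB a b"
        unfolding B using l(1) dvd_2_3 by (auto simp: prime_dvd_mult_iff dest: prime_dvd_power)
      thus False using AB by simp
    qed
    hence "\<not> l dvd - 3 * A0" using l(1) dvd_2_3 by (auto simp: prime_dvd_mult_iff)
    hence "coprime l (- 3 * A0)" by (rule prime_imp_coprime[OF l(1)])
    hence "coprime (l ^ 4) (- 3 * A0)" by (simp only: coprime_power_left_iff) simp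
    thus "l ^ 4 dvd famC a b" using h unfolding A by (simp only: coprime_dvd_mult_right_iff)
  qed
  thus ?thesis by (auto simp: good_def)
qed

text \<open>
  As \<open>famC x b = (x\<^sup>2 + 11 b\<^sup>2)\<^sup>2 + 4 b\<^sup>4\<close>, the polynomial has no double root modulo an odd prime
  other than 5.
\<close>

lemma power_dvd_diff_if_famC:
  fixes l x y b :: int
  assumes l: "Factorial_Ring.prime l" "l \<notin> {2, 5}" and "\<not> l dvd b" "l dvd famC x b" "l dvd x - y"
    and dvd: "l ^ k dvd famC x b - famC y b"
  shows "l ^ k dvd x - y"
proof -
  \<comment> \<open>\<open>h\<close> is the cofactor of \<open>x - y\<close> in
    \<open>famC x b - famC y b\<close>. As \<open>x\<close> and \<open>y\<close> agree modulo
    \<open>l\<close>, it is there the derivative \<open>4 * x * (x ^ 2 + 11 * b ^ 2)\<close> of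
    \<open>famC\<close> in its first argument.\<close>
  define h where "h = (x + y) * (x ^ 2 + y ^ 2 + 22 * b ^ 2)"
  have "\<not> l dvd 2" using l by (auto simp: primes_dvd_imp_eq)
  hence not4: "\<not> l dvd 4" using l(1) prime_dvd_mult_iff[of l 2 2] by simp
  have "\<not> l dvd h"
  proof
    assume "l dvd h"
    have "l dvd h + (x - y) * (3 * x ^ 2 + y ^ 2 + 2 * x * y + 22 * b ^ 2)"
      using \<open>l dvd h\<close> assms(5) by (intro dvd_add) auto
    also have "\<dots> = 4 * (x * (x ^ 2 + 11 * b ^ 2))"
      unfolding h_def by (simp add: algebra_simps power2_eq_square)
    finally have "l dvd x \<or> l dvd x ^ 2 + 11 * b ^ 2"
      using l(1) not4 by (simp add: prime_dvd_mult_iff)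
    moreover have "\<not> l dvd x"
      using prime_dvd_famC[of l x b] assms by auto
    ultimately have "l dvd x ^ 2 + 11 * b ^ 2" by simp
    hence "l dvd famC x b - (x ^ 2 + 11 * b ^ 2) * (x ^ 2 + 11 * b ^ 2)"
      using assms(4) by (intro dvd_diff) auto
    also have "\<dots> = 4 * b ^ 4"
      unfolding famC_def by (simp add: algebra_simps power2_eq_square eval_nat_numeral)
    finally show False using l(1) not4 assms(3) by (auto simp: prime_dvd_mult_iff dest: prime_dvd_power)
  qed
  hence "coprime (l ^ k) h" using l(1) by (simp add: prime_imp_coprime)
  moreover have "famC x b - famC y b = (x - y) * h"
    unfolding famC_def h_def by (simp add: algebra_simps power2_eq_square eval_nat_numeral)
  ultimately show ?thesis using dvd by (simp add: coprime_dvd_mult_left_iff)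
qed

section \<open>Roots of the quartic form modulo prime powers\<close>

lemma card_residue_class:
  fixes l n c :: int
  assumes "l > 0" "n \<ge> 0" "c \<in> {0..<l}"
  shows "card {a \<in> {0..<l * n}. a mod l = c} = nat n"
proof -
  have "bij_betw (\<lambda>k. c + l * k) {0..<n} {a \<in> {0..<l * n}. a mod l = c}"
  proof (rule bij_betwI[of _ _ _ "\<lambda>a. a div l"])
    show "(\<lambda>k. c + l * k) \<in> {0..<n} \<rightarrow> {a \<in> {0..<l * n}. a mod l = c}"
    proof
      fix k assume k: "k \<in> {0..<n}"
      hence "l * (k + 1) \<le> l * n" using assms by (intro mult_left_mono) auto
      thus "c + l * k \<in> {a \<in> {0..<l * n}. a mod l = c}" using assms k by (auto simp: algebra_simps)
    qed
    show "(\<lambda>a. a div l) \<in> {a \<in> {0..<l * n}. a mod l = c} \<rightarrow> {0..<n}"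
    proof
      fix a assume a: "a \<in> {a \<in> {0..<l * n}. a mod l = c}"
      have "l * (a div l) \<le> a" using assms(1) pos_mod_sign[of l a] mult_div_mod_eq[of l a] by linarith
      also have "a < l * n" using a by simp
      finally have "a div l < n" using assms(1) by (simp add: mult_less_cancel_left_pos)
      thus "a div l \<in> {0..<n}" using a assms(1) by (simp add: pos_imp_zdiv_nonneg_iff)
    qed
  qed (use assms in auto)
  from bij_betw_same_card[OF this] show ?thesis by simp
qed

lemma famC_mult: "famC (c * a) (c * b) = c ^ 4 * famC a b"
  by (simp add: famC_def power_mult_distrib algebra_simps flip: power_mult)

lemma famC_1: "famC t 1 = t ^ 4 + 22 * t ^ 2 + 125"
  by (simp add: famC_def)

lemma residue_mult_bij:
  fixes l b :: int
  assumes "coprime l b" "l > 0"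
  shows "bij_betw (\<lambda>t. (t * b) mod l) {0..<l} {0..<l}"
proof -
  have "inj_on (\<lambda>t. (t * b) mod l) {0..<l}"
  proof (rule inj_onI)
    fix s t assume st: "s \<in> {0..<l}" "t \<in> {0..<l}" "s * b mod l = t * b mod l"
    hence "[s = t] (mod l)"
      using assms(1) by (metis cong_def cong_mult_rcancel coprime_commute)
    thus "s = t" using st by (simp add: cong_def)
  qed
  moreover have "(\<lambda>t. (t * b) mod l) ` {0..<l} \<subseteq> {0..<l}"
    using assms(2) by auto
  ultimately show ?thesis
    by (intro bij_betw_imageI endo_inj_surj) auto
qed

text \<open>Homogeneity: for \<open>b\<close> invertible modulo \<open>l\<close>, the substitution
  \<open>a = t * b\<close> reduces the form to the quartic in \<open>t\<close>.\<close>

lemma card_famC_roots: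
  assumes l: "Factorial_Ring.prime l" and b: "\<not> int l dvd b"
  shows "card {a \<in> {0..<int l}. int l dvd famC a b} = root_count l"
proof -
  have pr: "Factorial_Ring.prime (int l)" using l by simp
  have cop: "coprime (int l) b" using prime_imp_coprime[OF pr b] .
  have iff: "int l dvd famC (t * b mod int l) b \<longleftrightarrow> int l dvd t ^ 4 + 22 * t ^ 2 + 125" for t
  proof -
    have "[t * b mod int l = t * b] (mod int l)" by (simp add: cong_def)
    hence "int l dvd famC (t * b mod int l) b \<longleftrightarrow> int l dvd famC (b * t) (b * 1)"
      by (intro cong_dvd_iff cong_fam) (auto simp: mult.commute)
    also have "\<dots> \<longleftrightarrow> int l dvd famC t 1"
      unfolding famC_mult using b pr prime_dvd_power[OF pr, of b 4]
      by (auto simp: prime_dvd_mult_iff)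
    finally show ?thesis by (simp add: famC_1)
  qed
  have "bij_betw (\<lambda>t. (t * b) mod int l) {t \<in> {0..<int l}. int l dvd t ^ 4 + 22 * t ^ 2 + 125}
      {a \<in> {0..<int l}. int l dvd famC a b}"
    using l by (intro bij_betw_Collect residue_mult_bij[OF cop] iff) (simp add: prime_gt_0_nat)
  from bij_betw_same_card[OF this] show ?thesis by (simp add: root_count_def)
qed

text \<open>Hensel's lemma by counting. On the class of \<open>r\<close> modulo \<open>l\<close>,
  the map \<open>a \<mapsto> famC a b mod l ^ 6\<close> is injective because the root is simple, and
  its values are multiples of \<open>l\<close>. Both sets have \<open>l ^ 5\<close> elements, so it
  is a bijection; the arguments sought correspond to the \<open>l ^ 2\<close> multiples of
  \<open>l ^ 4\<close>.\<close>

lemma card_famC_class: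
  assumes l: "Factorial_Ring.prime l" "l \<notin> {2, 5}" and b: "\<not> int l dvd b"
    and r: "r \<in> {0..<int l}" "int l dvd famC r b"
  shows "card {a \<in> {0..<int l ^ 6}. a mod int l = r \<and> int l ^ 4 dvd famC a b} = l ^ 2"
proof -
  let ?l = "int l"
  have pos: "?l > 0" using l by (simp add: prime_gt_0_nat)
  have pr: "Factorial_Ring.prime ?l" using l by simp
  have l': "?l \<notin> {2, 5}" using l by auto
  define S where "S = {a \<in> {0..<?l * ?l ^ 5}. a mod ?l = r}"
  define T where "T = {v \<in> {0..<?l * ?l ^ 5}. v mod ?l = 0}"
  define f where "f = (\<lambda>a. famC a b mod ?l ^ 6)"
  have l6: "?l * ?l ^ 5 = ?l ^ 6" "?l ^ 4 * ?l ^ 2 = ?l ^ 6" by (simp_all flip: power_Suc power_add)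
  have card: "card S = nat (?l ^ 5)" "card T = nat (?l ^ 5)"
    unfolding S_def T_def using pos r by (intro card_residue_class; simp)+
  have "S \<subseteq> {0..<?l * ?l ^ 5}" "T \<subseteq> {0..<?l * ?l ^ 5}" by (auto simp: S_def T_def)
  hence fin: "finite S" "finite T" by (blast intro: finite_subset[OF _ finite_atLeastLessThan_int])+
  have dvdC: "?l dvd famC a b" if "a \<in> S" for a
  proof -
    have "[a = r] (mod ?l)" using that r by (simp add: S_def cong_def)
    thus ?thesis using r cong_dvd_iff[OF cong_fam(1)[of a r ?l b b]] by simp
  qed
  have inj: "inj_on f S"
  proof (rule inj_onI)
    fix x y assume xy: "x \<in> S" "y \<in> S" "f x = f y"
    have "?l ^ 6 dvd famC x b - famC y b" using xy by (simp add: f_def mod_eq_dvd_iff)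
    moreover have "?l dvd x - y" using xy by (simp add: S_def flip: mod_eq_dvd_iff)
    ultimately have "?l ^ 6 dvd x - y"
      using power_dvd_diff_if_famC[OF pr l' b dvdC[OF xy(1)]] by blast
    hence "x mod ?l ^ 6 = y mod ?l ^ 6" by (simp add: mod_eq_dvd_iff)
    thus "x = y" using xy by (simp add: S_def l6)
  qed
  have "f ` S \<subseteq> T"
    using dvdC pos by (auto simp: f_def T_def l6 mod_mod_cancel dvd_imp_mod_0)
  hence "f ` S = T"
    using card inj fin by (intro card_subset_eq) (auto simp: card_image)
  hence bij: "bij_betw f S T" using inj by (simp add: bij_betw_def)
  have iff: "?l ^ 4 dvd f a \<longleftrightarrow> ?l ^ 4 dvd famC a b" for a
    unfolding f_def by (simp add: dvd_mod_iff le_imp_power_dvd)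
  have "card {a \<in> S. ?l ^ 4 dvd famC a b} = card {v \<in> T. ?l ^ 4 dvd v}"
  proof (rule bij_betw_same_card[of f])
    show "bij_betw f {a \<in> S. ?l ^ 4 dvd famC a b} {v \<in> T. ?l ^ 4 dvd v}"
      unfolding iff [symmetric] using bij by (auto simp: bij_betw_def inj_on_def)
  qed
  also have "{v \<in> T. ?l ^ 4 dvd v} = {v \<in> {0..<?l ^ 4 * ?l ^ 2}. v mod ?l ^ 4 = 0}"
    unfolding T_def l6 by (auto simp: dvd_imp_mod_0 mod_0_imp_dvd intro: dvd_trans[of ?l "?l ^ 4"])
  also have "card \<dots> = nat (?l ^ 2)"
    using pos by (intro card_residue_class) auto
  also have "{a \<in> S. ?l ^ 4 dvd famC a b} = {a \<in> {0..<?l ^ 6}. a mod ?l = r \<and> ?l ^ 4 dvd famC a b}"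
    unfolding S_def l6 by auto
  finally show ?thesis by (simp add: nat_power_eq)
qed

lemma card_famC_power_roots:
  assumes l: "Factorial_Ring.prime l" "l \<notin> {2, 5}" and b: "\<not> int l dvd b"
  shows "card {a \<in> {0..<int l ^ 6}. int l ^ 4 dvd famC a b} = root_count l * l ^ 2"
proof -
  let ?l = "int l"
  let ?R = "{r \<in> {0..<?l}. ?l dvd famC r b}"
  let ?S = "\<lambda>r. {a \<in> {0..<?l ^ 6}. a mod ?l = r \<and> ?l ^ 4 dvd famC a b}"
  have pos: "?l > 0" using l by (simp add: prime_gt_0_nat)
  have finite: "finite ?R" "finite (?S r)" for r
    by (rule finite_subset[of _ "{0..<?l}"] finite_subset[of _ "{0..<?l ^ 6}"]; auto)+
  have "a mod ?l \<in> ?R" if "?l ^ 4 dvd famC a b" for a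
  proof -
    have "?l dvd famC a b" using that by (rule dvd_trans[rotated]) simp
    moreover have "[a mod ?l = a] (mod ?l)" by (simp add: cong_def)
    ultimately show ?thesis using pos cong_dvd_iff[OF cong_fam(1)[of "a mod ?l" a ?l b b]] by simp
  qed
  hence "{a \<in> {0..<?l ^ 6}. ?l ^ 4 dvd famC a b} = (\<Union>r\<in>?R. ?S r)" by auto
  hence "card {a \<in> {0..<?l ^ 6}. ?l ^ 4 dvd famC a b} = card (\<Union>r\<in>?R. ?S r)" by (rule arg_cong)
  also have "\<dots> = (\<Sum>r\<in>?R. card (?S r))"
  proof (rule card_UN_disjoint)
    show "\<forall>r\<in>?R. finite (?S r)" using finite(2) by blast
    show "\<forall>r\<in>?R. \<forall>r'\<in>?R. r \<noteq> r' \<longrightarrow> ?S r \<inter> ?S r' = {}" by auto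
  qed (rule finite(1))
  also have "\<dots> = (\<Sum>r\<in>?R. l ^ 2)"
    by (intro sum.cong refl card_famC_class assms) auto
  also have "\<dots> = root_count l * l ^ 2"
    using card_famC_roots[OF l(1) b] by simp
  finally show ?thesis .
qed

text \<open>The \<open>l ^ 12\<close> pairs split into the good ones, the \<open>l ^ 10\<close> with
  both coordinates divisible by \<open>l\<close>, and those with \<open>b\<close> prime to
  \<open>l\<close> and \<open>l ^ 4\<close> dividing \<open>famC a b\<close>. The last kind has
  \<open>l ^ 6 - l ^ 5\<close> choices of \<open>b\<close> with \<open>root_count l * l ^ 2\<close>
  values of \<open>a\<close> each. No further case arises, since \<open>l\<close> dividing
  \<open>b\<close> and \<open>famC a b\<close> divides \<open>a\<close>.\<close>

lemma local_density_eq_euler_factor: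
  assumes l: "Factorial_Ring.prime l" "l \<notin> {2, 3, 5}"
  shows "local_density l = euler_factor l"
proof -
  let ?l = "int l"
  let ?I = "{0..<?l ^ 6}"
  have pos: "?l > 0" using l by (simp add: prime_gt_0_nat)
  have pr: "Factorial_Ring.prime ?l" using l by simp
  have l': "?l \<notin> {2, 3, 5}" using l by auto
  define M where "M = {v \<in> ?I. ?l dvd v}"
  define G where "G = {(a, b) \<in> ?I \<times> ?I. good ?l a b}"
  \<comment> \<open>Here \<open>b\<close> comes first, because the fibre of admissible
    \<open>a\<close> depends on it; \<open>prod.swap\<close> restores the order.\<close>
  define H where "H = (SIGMA b:?I - M. {a \<in> ?I. ?l ^ 4 dvd famC a b})"
  have l6: "?l * ?l ^ 5 = ?l ^ 6" by (simp flip: power_Suc)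
  have "M = {v \<in> {0..<?l * ?l ^ 5}. v mod ?l = 0}"
    by (auto simp: M_def l6 dvd_eq_mod_eq_0)
  hence cM: "card M = l ^ 5"
    using pos card_residue_class[of ?l "?l ^ 5" 0] by (simp add: nat_power_eq)
  have cI: "card ?I = l ^ 6" by (simp add: nat_power_eq)
  have MI: "M \<subseteq> ?I" by (auto simp: M_def)
  have fin: "finite ?I" "finite M" using finite_subset[OF MI] by auto
  have cIM: "card (?I - M) = l ^ 6 - l ^ 5"
    using card_Diff_subset[OF fin(2) MI] cI cM by simp
  have cH: "card H = (l ^ 6 - l ^ 5) * (root_count l * l ^ 2)"
  proof -
    have "card H = (\<Sum>b\<in>?I - M. card {a \<in> ?I. ?l ^ 4 dvd famC a b})"
      unfolding H_def by (rule card_SigmaI) (auto intro: finite_subset[of _ ?I])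
    also have "\<dots> = (\<Sum>b\<in>?I - M. root_count l * l ^ 2)"
      using l by (intro sum.cong refl card_famC_power_roots) (auto simp: M_def)
    finally show ?thesis using cIM by simp
  qed
  have key: "?l dvd b \<Longrightarrow> ?l ^ 4 dvd famC a b \<Longrightarrow> ?l dvd a" for a b
    using prime_dvd_famC[OF pr, of a b] l' dvd_trans[of ?l "?l ^ 4" "famC a b"] by auto
  have swapH: "(a, b) \<in> prod.swap ` H \<longleftrightarrow> (b, a) \<in> H" for a b
    by (metis (no_types) imageE image_eqI swap_simp swap_swap)
  have G: "(a, b) \<in> G \<longleftrightarrow> a \<in> ?I \<and> b \<in> ?I \<and> \<not> (?l dvd a \<and> ?l dvd b) \<and> \<not> ?l ^ 4 dvd famC a b"
    and H: "(b, a) \<in> H \<longleftrightarrow> a \<in> ?I \<and> b \<in> ?I \<and> \<not> ?l dvd b \<and> ?l ^ 4 dvd famC a b"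
    and M: "a \<in> M \<longleftrightarrow> a \<in> ?I \<and> ?l dvd a" for a b
    by (simp add: G_def good_iff[OF pr l'], simp add: H_def M_def, blast, simp only: M_def mem_Collect_eq)
  have "?I \<times> ?I = G \<union> (M \<times> M \<union> prod.swap ` H)"
    unfolding set_eq_iff split_paired_All Un_iff mem_Times_iff fst_conv snd_conv swapH G H M
    using key by blast
  moreover have "G \<inter> (M \<times> M \<union> prod.swap ` H) = {}"
    unfolding set_eq_iff split_paired_All Un_iff Int_iff mem_Times_iff fst_conv snd_conv swapH G H M
    by blast
  moreover have "(M \<times> M) \<inter> prod.swap ` H = {}"
    unfolding set_eq_iff split_paired_All Un_iff Int_iff mem_Times_iff fst_conv snd_conv swapH G H M
    by blast
  moreover have "G \<subseteq> ?I \<times> ?I" "H \<subseteq> ?I \<times> ?I" unfolding G_def H_def by blast+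
  hence "finite G" "finite H"
    by (blast intro: finite_subset[OF _ finite_cartesian_product[OF fin(1) fin(1)]])+
  ultimately have "card (?I \<times> ?I) = card G + (card (M \<times> M) + card (prod.swap ` H))"
    using fin by (simp add: card_Un_disjoint)
  moreover have "card (prod.swap ` H) = card H" by (simp add: card_image)
  ultimately have "l ^ 6 * l ^ 6 = card G + (l ^ 5 * l ^ 5 + (l ^ 6 - l ^ 5) * (root_count l * l ^ 2))"
    by (simp only: card_cartesian_product cI cM cH)
  hence "real (l ^ 6 * l ^ 6) = real (card G) + (real (l ^ 5 * l ^ 5) + real (l ^ 6 - l ^ 5) * (real (root_count l) * real (l ^ 2)))"
    by (metis of_nat_add of_nat_mult)
  moreover have "real (l ^ 6 - l ^ 5) = real l ^ 6 - real l ^ 5"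
    using pos by (subst of_nat_diff) (auto intro: power_increasing)
  ultimately have "real (card G) = real l ^ 12 - real l ^ 10 - (real l ^ 6 - real l ^ 5) * (real (root_count l) * real l ^ 2)"
    by (simp flip: power_add)
  moreover have "local_density l = real (card G) / real l ^ 12"
    by (simp add: local_density_eq residue_count_def G_def)
  ultimately have "local_density l =
      (real l ^ 12 - real l ^ 10 - (real l ^ 6 - real l ^ 5) * (real (root_count l) * real l ^ 2)) / real l ^ 12"
    by (simp only:)
  also have "\<dots> = euler_factor l"
    using pos by (simp add: euler_factor_def field_simps eval_nat_numeral)
  finally show ?thesis .
qed

text \<open>The quartic is a quadratic in \<open>t ^ 2\<close>: two roots \<open>s\<close> and
  \<open>t\<close> satisfy \<open>t ^ 2 = s ^ 2\<close> or \<open>t ^ 2 + s ^ 2 = - 22\<close>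
  modulo \<open>l\<close>. So at most two squares occur, and each has at most two square
  roots.\<close>

lemma root_count_le_4:
  assumes l: "Factorial_Ring.prime l"
  shows "root_count l \<le> 4"
proof -
  let ?l = "int l"
  have pr: "Factorial_Ring.prime ?l" using l by simp
  define R where "R = {t \<in> {0..<?l}. ?l dvd t ^ 4 + 22 * t ^ 2 + 125}"
  have four: "card {a mod ?l, b mod ?l, c mod ?l, d mod ?l} \<le> 4" for a b c d
    using card_length[of "[a mod ?l, b mod ?l, c mod ?l, d mod ?l]"] by simp
  have eqI: "t = c mod ?l" if "t \<in> R" "?l dvd t - c" for t c
    using that by (auto simp: R_def simp flip: mod_eq_dvd_iff)
  have sq: "t = s mod ?l \<or> t = (- s) mod ?l" if "t \<in> R" "?l dvd t ^ 2 - s ^ 2" for s t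
  proof -
    have "t ^ 2 - s ^ 2 = (t - s) * (t - (- s))" by (simp add: algebra_simps power2_eq_square)
    hence "?l dvd t - s \<or> ?l dvd t - (- s)" using that(2) pr by (simp only: prime_dvd_mult_iff)
    thus ?thesis using eqI[OF that(1)] by blast
  qed
  have split: "?l dvd t ^ 2 - s ^ 2 \<or> ?l dvd t ^ 2 + s ^ 2 + 22" if "t \<in> R" "s \<in> R" for s t
  proof -
    have "?l dvd (t ^ 4 + 22 * t ^ 2 + 125) - (s ^ 4 + 22 * s ^ 2 + 125)"
      using that by (intro dvd_diff) (auto simp: R_def)
    also have "\<dots> = (t ^ 2 - s ^ 2) * (t ^ 2 + s ^ 2 + 22)"
      by (simp add: algebra_simps power2_eq_square eval_nat_numeral)
    finally show ?thesis using pr by (simp only: prime_dvd_mult_iff)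
  qed
  have "\<exists>a b. R \<subseteq> {a mod ?l, (- a) mod ?l, b mod ?l, (- b) mod ?l}"
  proof (cases "R = {}")
    case False
    then obtain a where a: "a \<in> R" by auto
    show ?thesis
    proof (cases "\<forall>t\<in>R. ?l dvd t ^ 2 - a ^ 2")
      case True
      thus ?thesis using sq by blast
    next
      case False
      then obtain b where b: "b \<in> R" "\<not> ?l dvd b ^ 2 - a ^ 2" by blast
      hence b': "?l dvd b ^ 2 + a ^ 2 + 22" using split a by blast
      have "?l dvd t ^ 2 - a ^ 2 \<or> ?l dvd t ^ 2 - b ^ 2" if "t \<in> R" for t
        using split[OF that a] dvd_diff[OF _ b', of "t ^ 2 + a ^ 2 + 22"] by auto
      thus ?thesis using sq by blast
    qed
  qed auto
  then obtain a b where "R \<subseteq> {a mod ?l, (- a) mod ?l, b mod ?l, (- b) mod ?l}" by blast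
  hence "card R \<le> card {a mod ?l, (- a) mod ?l, b mod ?l, (- b) mod ?l}" by (intro card_mono) auto
  also have "\<dots> \<le> 4" by (rule four)
  finally show ?thesis by (simp add: root_count_def R_def)
qed

section \<open>Large primes\<close>

definition lattice_box :: "real \<Rightarrow> (int \<times> int) set" where
  "lattice_box N = {(a, b). \<bar>of_int a\<bar> \<le> N \<and> 0 < b \<and> of_int b \<le> N}"

lemma lattice_box_eq: "lattice_box N = {- \<lfloor>N\<rfloor>..\<lfloor>N\<rfloor>} \<times> {1..\<lfloor>N\<rfloor>}"
  by (auto simp: lattice_box_def le_floor_iff abs_le_iff) linarith+

lemma finite_lattice_box: "finite (lattice_box N)"
  by (simp add: lattice_box_eq)

lemma card_pairwise_cong_le:
  fixes S :: "int set" and m :: int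
  assumes m: "m > 0" and N: "N \<ge> 0" and bound: "\<And>a. a \<in> S \<Longrightarrow> \<bar>of_int a\<bar> \<le> N"
    and cong: "\<And>a a'. a \<in> S \<Longrightarrow> a' \<in> S \<Longrightarrow> m dvd a - a'"
  shows "real (card S) \<le> 2 * N / of_int m + 1"
proof (cases "S = {}")
  case False
  have fin: "finite S"
  proof (rule finite_subset)
    show "S \<subseteq> {- \<lfloor>N\<rfloor>..\<lfloor>N\<rfloor>}"
    proof
      fix a assume "a \<in> S"
      hence "of_int a \<le> N" "of_int (- a) \<le> N" using bound[of a] by (simp_all add: abs_le_iff)
      hence "a \<le> \<lfloor>N\<rfloor>" "- a \<le> \<lfloor>N\<rfloor>" by (simp_all only: le_floor_iff)
      thus "a \<in> {- \<lfloor>N\<rfloor>..\<lfloor>N\<rfloor>}" by simp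
    qed
  qed simp
  define a0 where "a0 = Min S"
  have a0: "a0 \<in> S" "\<And>a. a \<in> S \<Longrightarrow> a0 \<le> a" using fin False by (auto simp: a0_def)
  define f where "f = (\<lambda>a. (a - a0) div m)"
  have f: "a = a0 + m * f a" if "a \<in> S" for a
    using cong[OF that a0(1)] by (simp add: f_def)
  have "inj_on f S" by (rule inj_onI) (metis f)
  moreover have "f ` S \<subseteq> {0..\<lfloor>2 * N / of_int m\<rfloor>}"
  proof (rule image_subsetI)
    fix a assume a: "a \<in> S"
    have "of_int m * of_int (f a) = (of_int (a - a0) :: real)"
      using f[OF a] by (metis add_diff_cancel_left' of_int_mult)
    also have "\<dots> \<le> 2 * N" using bound[OF a] bound[OF a0(1)] by simp
    finally have "of_int (f a) \<le> 2 * N / of_int m" using m by (simp add: field_simps)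
    moreover have "0 \<le> f a" using a0(2)[OF a] m by (simp add: f_def pos_imp_zdiv_nonneg_iff)
    ultimately show "f a \<in> {0..\<lfloor>2 * N / of_int m\<rfloor>}" by (simp add: le_floor_iff)
  qed
  ultimately have "card S \<le> card {0..\<lfloor>2 * N / of_int m\<rfloor>}"
    by (metis card_image card_mono finite_atLeastAtMost_int)
  also have "\<dots> = nat (\<lfloor>2 * N / of_int m\<rfloor> + 1)" by simp
  finally have "real (card S) \<le> real (nat (\<lfloor>2 * N / of_int m\<rfloor> + 1))" by simp
  moreover have "2 * N / of_int m \<ge> 0" using m N by simp
  ultimately show ?thesis by linarith
qed (use m N in simp)

lemma famC_pos:
  fixes a b :: "'a :: linordered_idom"
  assumes "b \<noteq> 0"
  shows "famC a b > 0"
proof -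
  have "0 \<le> a ^ 4" "0 \<le> a ^ 2 * b ^ 2" "0 < b ^ 4" using assms by auto
  thus ?thesis by (simp add: famC_def mult.assoc add_nonneg_pos)
qed

lemma famC_root_class:
  assumes l: "Factorial_Ring.prime l" "l \<noteq> 5" and cop: "coprime a b" and dvd: "int l ^ 4 dvd famC a b"
  shows "\<not> int l dvd b" "\<exists>t\<in>{0..<int l}. int l dvd t ^ 4 + 22 * t ^ 2 + 125 \<and> int l dvd a - t * b"
proof -
  let ?l = "int l"
  have pr: "Factorial_Ring.prime ?l" using l by simp
  have pos: "?l > 0" using l by (simp add: prime_gt_0_nat)
  have l': "?l \<noteq> 5" using l by auto
  have ldvd: "?l dvd famC a b" using dvd by (rule dvd_trans[rotated]) simp
  show nb: "\<not> ?l dvd b"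
  proof
    assume "?l dvd b"
    hence "?l dvd a" "?l dvd b" using prime_dvd_famC[OF pr l' ldvd] by auto
    thus False using cop pr by (meson coprime_common_divisor not_prime_unit)
  qed
  have "a mod ?l \<in> {0..<?l}" using pos by simp
  also have "{0..<?l} = (\<lambda>t. t * b mod ?l) ` {0..<?l}"
    using residue_mult_bij[OF prime_imp_coprime[OF pr nb] pos] by (simp add: bij_betw_def)
  finally obtain t where t: "t \<in> {0..<?l}" "a mod ?l = t * b mod ?l" by auto
  have "[a = b * t] (mod ?l)" using t(2) by (simp add: cong_def mult.commute)
  hence "?l dvd famC (b * t) (b * 1)"
    using ldvd cong_dvd_iff[OF cong_fam(1)[of a "b * t" ?l b b]] by simp
  hence "?l dvd b ^ 4 \<or> ?l dvd famC t 1"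
    unfolding famC_mult using pr by (simp only: prime_dvd_mult_iff)
  hence "?l dvd t ^ 4 + 22 * t ^ 2 + 125"
    using nb prime_dvd_power[OF pr] by (auto simp: famC_1)
  thus "\<exists>t\<in>{0..<?l}. ?l dvd t ^ 4 + 22 * t ^ 2 + 125 \<and> ?l dvd a - t * b"
    using t by (auto simp flip: mod_eq_dvd_iff)
qed

text \<open>Scaling by \<open>b'\<close> and by \<open>b\<close> gives both points the second
  coordinate \<open>b * b'\<close>. Their first coordinates \<open>a * b'\<close> and
  \<open>a' * b\<close> agree modulo \<open>l\<close> and are roots modulo \<open>l ^ 4\<close>, and
  a simple root lifts uniquely.\<close>

lemma famC_root_class_dvd_det:
  assumes l: "Factorial_Ring.prime l" "l \<notin> {2, 5}" and nb: "\<not> int l dvd b" "\<not> int l dvd b'"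
    and dvd: "int l ^ 4 dvd famC a b" "int l ^ 4 dvd famC a' b'"
    and cls: "int l dvd a - t * b" "int l dvd a' - t * b'"
  shows "int l ^ 4 dvd a * b' - a' * b"
proof -
  let ?l = "int l"
  have pr: "Factorial_Ring.prime ?l" using l by simp
  have l': "?l \<notin> {2, 5}" using l by auto
  have eq: "famC (a * b') (b * b') = b' ^ 4 * famC a b" "famC (a' * b) (b * b') = b ^ 4 * famC a' b'"
    using famC_mult[of b' a b] famC_mult[of b a' b'] by (simp_all add: mult.commute)
  show ?thesis
  proof (rule power_dvd_diff_if_famC[OF pr l'])
    show "\<not> ?l dvd b * b'" using nb pr by (simp add: prime_dvd_mult_iff)
    show "?l dvd famC (a * b') (b * b')"
      unfolding eq using dvd(1) by (meson dvd_mult dvd_power dvd_trans zero_less_numeral)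
    have "?l dvd (a - t * b) * b' - (a' - t * b') * b" using cls by (intro dvd_diff) auto
    thus "?l dvd a * b' - a' * b" by (simp add: algebra_simps)
    show "?l ^ 4 dvd famC (a * b') (b * b') - famC (a' * b) (b * b')"
      unfolding eq using dvd by (intro dvd_diff) auto
  qed
qed

text \<open>
  Two primitive vectors in the same class span a lattice whose determinant is divisible by
  \<open>l\<^sup>4\<close>, so for \<open>l\<^sup>4 > 2 N\<^sup>2\<close> each class contains at most one of them.
\<close>

lemma card_famC_tail:
  assumes l: "Factorial_Ring.prime l" "l \<notin> {2, 5}" and N: "N \<ge> 1"
  defines "T \<equiv> {(a, b) \<in> lattice_box N. coprime a b \<and> int l ^ 4 dvd famC a b}"
  shows "real (card T) \<le> 4 * (N * (2 * N / real l ^ 4 + 1))"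
    and "2 * N ^ 2 < real l ^ 4 \<Longrightarrow> card T \<le> 4"
    and "4 * N < real l \<Longrightarrow> T = {}"
proof -
  let ?l = "int l"
  have pos: "?l > 0" using l by (simp add: prime_gt_0_nat)
  define R where "R = {t \<in> {0..<?l}. ?l dvd t ^ 4 + 22 * t ^ 2 + 125}"
  define C where "C = (\<lambda>t. {(a, b) \<in> T. ?l dvd a - t * b})"
  have finT: "finite T" using finite_lattice_box[of N] by (rule rev_finite_subset) (auto simp: T_def)
  have CT: "C t \<subseteq> T" for t by (auto simp: C_def)
  have finC: "finite (C t)" for t using finite_subset[OF CT finT] .
  have finR: "finite R" by (rule finite_subset[of _ "{0..<?l}"]) (auto simp: R_def)
  have cR: "card R \<le> 4" using root_count_le_4[OF l(1)] by (simp add: root_count_def R_def)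
  have nb: "\<not> ?l dvd b" if "(a, b) \<in> T" for a b
    using famC_root_class(1)[OF l(1), of a b] l(2) that by (auto simp: T_def)
  have "T \<subseteq> (\<Union>t\<in>R. C t)"
  proof
    fix q assume q: "q \<in> T"
    obtain a b where ab: "q = (a, b)" by (cases q)
    obtain t where "t \<in> R" "?l dvd a - t * b"
      using famC_root_class(2)[OF l(1), of a b] l(2) q by (auto simp: T_def ab R_def)
    thus "q \<in> (\<Union>t\<in>R. C t)" using q by (auto simp: C_def ab)
  qed
  hence "card T \<le> card (\<Union>t\<in>R. C t)" using finR finC by (intro card_mono) auto
  also have "\<dots> \<le> (\<Sum>t\<in>R. card (C t))" by (rule card_UN_le[OF finR])
  finally have sum: "card T \<le> (\<Sum>t\<in>R. card (C t))" .
  have count: "real (card T) \<le> 4 * K" if "K \<ge> 0" "\<And>t. real (card (C t)) \<le> K" for K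
  proof -
    have "real (card T) \<le> (\<Sum>t\<in>R. real (card (C t)))"
      using sum by (metis of_nat_le_iff of_nat_sum)
    also have "\<dots> \<le> (\<Sum>t\<in>R. K)" by (intro sum_mono that)
    also have "\<dots> \<le> 4 * K" using cR that(1) by (simp add: mult_right_mono)
    finally show ?thesis .
  qed
  have det: "?l ^ 4 dvd a * b' - a' * b" if "(a, b) \<in> C t" "(a', b') \<in> C t" for a b a' b' t
    using that CT[of t] nb
    by (intro famC_root_class_dvd_det[OF l]) (auto simp: C_def T_def)
  have box: "\<bar>of_int a\<bar> \<le> N" "0 < b" "of_int b \<le> N" "coprime a b" if "(a, b) \<in> C t" for a b t
    using that by (auto simp: C_def T_def lattice_box_def)
  \<comment> \<open>For equal second coordinates the determinant is \<open>(a - a') * b\<close> with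
    \<open>b\<close> prime to \<open>l\<close>. So on each line of fixed \<open>b\<close> the points
    of one class share their first coordinate modulo \<open>l ^ 4\<close>.\<close>
  show "real (card T) \<le> 4 * (N * (2 * N / real l ^ 4 + 1))"
  proof (rule count)
    fix t
    let ?F = "\<lambda>b. {a. (a, b) \<in> C t}"
    have F: "real (card (?F b)) \<le> 2 * N / real l ^ 4 + 1" for b
    proof -
      have "real (card (?F b)) \<le> 2 * N / of_int (?l ^ 4) + 1"
      proof (rule card_pairwise_cong_le)
        fix a a' assume a: "a \<in> ?F b" "a' \<in> ?F b"
        have "?l ^ 4 dvd (a - a') * b" using det[of a b t a' b] a by (simp add: algebra_simps)
        moreover have "\<not> ?l dvd b" using a CT[of t] nb by blast
        hence "coprime (?l ^ 4) b" using l(1) by (simp add: prime_imp_coprime)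
        ultimately show "?l ^ 4 dvd a - a'" by (simp only: coprime_dvd_mult_left_iff)
      qed (use pos N box in auto)
      thus ?thesis by simp
    qed
    have finF: "finite (?F b)" for b
      using finC[of t] by (rule finite_surj[of _ _ fst]) force
    have "C t \<subseteq> prod.swap ` (SIGMA b:{1..\<lfloor>N\<rfloor>}. ?F b)"
    proof
      fix q assume q: "q \<in> C t"
      obtain a b where ab: "q = (a, b)" by (cases q)
      have "b \<in> {1..\<lfloor>N\<rfloor>}" using box[of a b t] q by (simp add: ab le_floor_iff)
      hence "(b, a) \<in> (SIGMA b:{1..\<lfloor>N\<rfloor>}. ?F b)" using q by (simp add: ab)
      thus "q \<in> prod.swap ` (SIGMA b:{1..\<lfloor>N\<rfloor>}. ?F b)" by (rule rev_image_eqI) (simp add: ab)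
    qed
    hence "card (C t) \<le> card (SIGMA b:{1..\<lfloor>N\<rfloor>}. ?F b)"
      using finF by (intro surj_card_le) auto
    also have "\<dots> = (\<Sum>b\<in>{1..\<lfloor>N\<rfloor>}. card (?F b))" using finF by (intro card_SigmaI) auto
    finally have "real (card (C t)) \<le> (\<Sum>b\<in>{1..\<lfloor>N\<rfloor>}. real (card (?F b)))"
      by (metis of_nat_le_iff of_nat_sum)
    also have "\<dots> \<le> (\<Sum>b\<in>{1..\<lfloor>N\<rfloor>}. 2 * N / real l ^ 4 + 1)" by (intro sum_mono F)
    also have "\<dots> = real (nat \<lfloor>N\<rfloor>) * (2 * N / real l ^ 4 + 1)" by simp
    also have "\<dots> \<le> N * (2 * N / real l ^ 4 + 1)"
      using N by (intro mult_right_mono) auto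
    finally show "real (card (C t)) \<le> N * (2 * N / real l ^ 4 + 1)" .
  qed (use N in auto)
  show "card T \<le> 4" if big: "2 * N ^ 2 < real l ^ 4"
  proof -
    have "card (C t) \<le> 1" for t
    proof (rule card_le_Suc0_iff_eq[THEN iffD2, simplified One_nat_def[symmetric]])
      show "finite (C t)" by (rule finC)
      show "\<forall>p\<in>C t. \<forall>q\<in>C t. p = q"
      proof clarify
        fix a b a' b' assume ab: "(a, b) \<in> C t" "(a', b') \<in> C t"
        have "\<bar>of_int a * of_int b'\<bar> \<le> N * N" "\<bar>of_int a' * of_int b\<bar> \<le> N * N"
          using box[OF ab(1)] box[OF ab(2)] N unfolding abs_mult by (intro mult_mono; simp)+
        hence "\<bar>of_int (a * b' - a' * b)\<bar> \<le> 2 * N ^ 2"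
          by (simp add: power2_eq_square abs_le_iff)
        also have "\<dots> < of_int (?l ^ 4)" using big by simp
        finally have "\<bar>a * b' - a' * b\<bar> < ?l ^ 4" by linarith
        hence eq: "a * b' = a' * b"
          using dvd_imp_le_int[OF _ det[OF ab]] by fastforce
        \<comment> \<open>The vectors are now parallel. Primitivity makes their second coordinates
          divide each other, and positivity rules out the opposite vector.\<close>
        have "b dvd b'" using eq box(4)[OF ab(1)]
          by (metis coprime_commute coprime_dvd_mult_right_iff dvd_triv_right)
        moreover have "b' dvd b" using eq box(4)[OF ab(2)]
          by (metis coprime_commute coprime_dvd_mult_right_iff dvd_triv_right)
        ultimately have "b = b'" using box(2)[OF ab(1)] box(2)[OF ab(2)] by (simp add: zdvd_antisym_nonneg)
        thus "a = a' \<and> b = b'" using eq box(2)[OF ab(1)] by simp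
      qed
    qed
    thus ?thesis using count[of 1] by force
  qed
  \<comment> \<open>On the box \<open>famC\<close> is at most \<open>(1 + 22 + 125) * N ^ 4\<close>,
    which is below \<open>(4 * N) ^ 4 = 256 * N ^ 4\<close>; a positive value cannot be divisible by
    a larger \<open>l ^ 4\<close>.\<close>
  show "T = {}" if big: "4 * N < real l"
  proof (rule ccontr)
    assume "T \<noteq> {}"
    then obtain a b where ab: "(a, b) \<in> T" by auto
    hence h: "\<bar>real_of_int a\<bar> \<le> N" "0 < b" "of_int b \<le> N" "?l ^ 4 dvd famC a b"
      by (auto simp: T_def lattice_box_def)
    have "famC a b > 0" using h(2) by (simp add: famC_pos)
    hence "?l ^ 4 \<le> famC a b" using h(4) zdvd_imp_le by blast
    hence "real l ^ 4 \<le> of_int (famC a b)" by (metis of_int_le_iff of_int_of_nat_eq of_int_power)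
    also have "\<dots> = of_int a ^ 4 + 22 * (of_int a ^ 2 * of_int b ^ 2) + 125 * of_int b ^ 4"
      by (simp add: famC_def)
    also have "\<dots> \<le> N ^ 4 + 22 * (N ^ 2 * N ^ 2) + 125 * N ^ 4"
    proof -
      have "of_int a ^ 4 \<le> N ^ 4" "(of_int a :: real) ^ 2 \<le> N ^ 2"
        using power_mono[OF h(1), of 4] power_mono[OF h(1), of 2] by (simp_all add: power_even_abs)
      moreover have "(of_int b :: real) ^ 2 \<le> N ^ 2" "(of_int b :: real) ^ 4 \<le> N ^ 4"
        using h by (intro power_mono; simp)+
      ultimately show ?thesis by (intro add_mono mult_left_mono mult_mono) auto
    qed
    also have "\<dots> = 148 * N ^ 4" by (simp flip: power_add)
    also have "\<dots> \<le> (4 * N) ^ 4" using N by (simp add: power_mult_distrib)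
    also have "\<dots> < real l ^ 4" using big N by (intro power_strict_mono) auto
    finally show False by simp
  qed
qed

text \<open>As \<open>b\<close> is positive, its multiples of \<open>l\<close> number at most
  \<open>N / l\<close> without an additive term. The extra 1 in the count of \<open>a\<close> is
  absorbed for \<open>l \<le> N\<close>: \<open>2 * N / l + 1 \<le> 3 * N / l\<close>.\<close>

lemma card_both_dvd:
  assumes l: "l > 0" and N: "N \<ge> 1"
  defines "G \<equiv> {(a, b) \<in> lattice_box N. int l dvd a \<and> int l dvd b}"
  shows "real (card G) \<le> 3 * N ^ 2 / real l ^ 2" and "N < real l \<Longrightarrow> G = {}"
proof -
  show empty: "G = {}" if "N < real l"
  proof -
    have "b \<ge> int l" if "int l dvd b" "b > 0" for b using that by (simp add: zdvd_imp_le)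
    thus ?thesis using that by (force simp: G_def lattice_box_def)
  qed
  show "real (card G) \<le> 3 * N ^ 2 / real l ^ 2"
  proof (cases "N < real l")
    case False
    let ?A = "{a. \<bar>real_of_int a\<bar> \<le> N \<and> int l dvd a}" and ?B = "{b. 0 < b \<and> real_of_int b \<le> N \<and> int l dvd b}"
    have A: "real (card ?A) \<le> 2 * N / real l + 1"
      using card_pairwise_cong_le[of "int l" N ?A] l N by auto
    have B: "real (card ?B) \<le> N / real l"
    proof -
      have "?B \<subseteq> (\<lambda>k. int l * k) ` {1..\<lfloor>N / real l\<rfloor>}"
      proof
        fix b assume b: "b \<in> ?B"
        then obtain k where k: "b = int l * k" by auto
        have "real l * of_int k \<le> N" using b by (simp add: k)
        hence "of_int k \<le> N / real l" using l by (simp add: field_simps)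
        moreover have "k \<ge> 1" using b l by (simp add: k zero_less_mult_iff)
        ultimately show "b \<in> (\<lambda>k. int l * k) ` {1..\<lfloor>N / real l\<rfloor>}"
          by (auto simp: k le_floor_iff)
      qed
      hence "card ?B \<le> card {1..\<lfloor>N / real l\<rfloor>}" by (intro surj_card_le) auto
      moreover have "N / real l \<ge> 0" using N by simp
      ultimately show ?thesis by simp linarith
    qed
    have "G = ?A \<times> ?B" by (auto simp: G_def lattice_box_def)
    hence "real (card G) = real (card ?A) * real (card ?B)" by (simp add: card_cartesian_product)
    also have "\<dots> \<le> (2 * N / real l + 1) * (N / real l)"
      using A B N by (intro mult_mono) auto
    also have "\<dots> \<le> (2 * N / real l + N / real l) * (N / real l)"
      using False l N by (intro mult_right_mono add_left_mono) (auto simp: field_simps)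
    also have "\<dots> = 3 * N ^ 2 / real l ^ 2" using l by (simp add: field_simps power2_eq_square)
    finally show ?thesis .
  qed (use N empty in auto)
qed

text \<open>Comparison with the telescoping sum of \<open>1 / (l - 1) - 1 / l\<close>. The resulting
  \<open>1 / z\<close> is what makes the part of the tail of order \<open>N ^ 2\<close>
  small.\<close>

lemma sum_inverse_squares_le:
  fixes z n :: nat
  assumes "z > 0"
  shows "(\<Sum>l\<in>{z<..n}. 1 / real l ^ 2) \<le> 1 / real z"
proof (cases "z \<le> n")
  case True
  have "(\<Sum>l\<in>{z<..n}. 1 / real l ^ 2) \<le> 1 / real z - 1 / real n"
    using True
  proof (induction n rule: dec_induct)
    case (step n)
    have "1 / real (Suc n) ^ 2 \<le> 1 / real n - 1 / real (Suc n)"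
      using step assms by (simp add: divide_simps power2_eq_square)
    moreover have "{z<..Suc n} = insert (Suc n) {z<..n}" using step by auto
    ultimately show ?case using step by simp
  qed simp
  thus ?thesis using assms True by (smt (verit) divide_nonneg_nonneg of_nat_0_le_iff)
qed auto

definition large_prime_exceptions :: "nat \<Rightarrow> real \<Rightarrow> (int \<times> int) set" where
  "large_prime_exceptions z N = {(a, b) \<in> lattice_box N. \<exists>l>z. Factorial_Ring.prime l \<and>
     (int l dvd a \<and> int l dvd b \<or> coprime a b \<and> int l ^ 4 dvd famC a b)}"

text \<open>The constant 11 is 3 from points divisible by \<open>l\<close> plus 8 from the density
  term of the root classes. The next term is \<open>4 * N\<close> for each of at most
  \<open>2 * sqrt N\<close> primes in \<open>P\<close>, and the last is 4 for each of at most
  \<open>4 * N\<close> primes in all. Primes are counted as if they were all the integers.\<close>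

lemma card_large_prime_exceptions:
  assumes z: "z \<ge> 5" and N: "N \<ge> 1"
  shows "real (card (large_prime_exceptions z N)) \<le> 11 * N ^ 2 / real z + 8 * (N * sqrt N) + 16 * N"
proof -
  define n where "n = nat \<lfloor>4 * N\<rfloor>"
  define L where "L = {l \<in> {z<..n}. Factorial_Ring.prime l}"
  define T where "T = (\<lambda>l. {(a, b) \<in> lattice_box N. coprime a b \<and> int l ^ 4 dvd famC a b})"
  define G where "G = (\<lambda>l. {(a, b) \<in> lattice_box N. int l dvd a \<and> int l dvd b})"
  have finL: "finite L" by (auto simp: L_def)
  have L: "Factorial_Ring.prime l" "l \<notin> {2, 5}" "l > z" "l > 0" if "l \<in> L" for l
    using that z by (auto simp: L_def)
  have fin: "finite (G l)" "finite (T l)" for l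
    using finite_lattice_box[of N] by (auto intro: rev_finite_subset simp: G_def T_def)
  have sub: "large_prime_exceptions z N \<subseteq> (\<Union>l\<in>L. G l \<union> T l)"
  proof
    fix q assume q: "q \<in> large_prime_exceptions z N"
    obtain a b where ab: "q = (a, b)" by (cases q)
    obtain l where l: "l > z" "Factorial_Ring.prime l" "(a, b) \<in> G l \<union> T l"
      using q by (auto simp: large_prime_exceptions_def ab G_def T_def)
    have "real l \<le> 4 * N"
    proof (rule ccontr)
      assume "\<not> real l \<le> 4 * N"
      hence "G l = {}" "T l = {}"
        using card_both_dvd(2)[of l N] card_famC_tail(3)[OF l(2), of N] l z N
        by (auto simp: G_def T_def)
      thus False using l(3) by simp
    qed
    hence "l \<in> L" using l by (simp add: L_def n_def le_nat_floor)
    thus "q \<in> (\<Union>l\<in>L. G l \<union> T l)" using l(3) ab by blast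
  qed
  \<comment> \<open>Outside \<open>P\<close> the determinant argument applies:
    \<open>real l > 2 * sqrt N\<close> means \<open>real l ^ 4 > 16 * N ^ 2\<close>, which is more
    than the required \<open>2 * N ^ 2\<close>.\<close>
  define P where "P = {l \<in> L. real l \<le> 2 * sqrt N}"
  have bound: "real (card (T l)) \<le> 8 * N ^ 2 * (1 / real l ^ 2) + (if l \<in> P then 4 * N else 0) + 4" if "l \<in> L" for l
  proof (cases "2 * N ^ 2 < real l ^ 4")
    case True
    hence "real (card (T l)) \<le> 4"
      using card_famC_tail(2)[OF L(1,2)[OF that] N] by (simp add: T_def)
    moreover have "0 \<le> 8 * N ^ 2 * (1 / real l ^ 2)" "0 \<le> (if l \<in> P then 4 * N else 0)" using N by auto
    ultimately show ?thesis by linarith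
  next
    case False
    have "real l ^ 4 \<le> 16 * N ^ 2"
      using False by (smt (verit) zero_le_power2)
    also have "\<dots> = (2 * sqrt N) ^ 4"
    proof -
      have "(2 * sqrt N) ^ 4 = 16 * (sqrt N ^ 2) ^ 2" by (simp add: power_mult_distrib flip: power_mult)
      thus ?thesis using N by simp
    qed
    finally have "real l \<le> 2 * sqrt N"
      using N by (subst (asm) power_mono_iff) auto
    hence P: "l \<in> P" using that by (simp add: P_def)
    have "8 * N ^ 2 / real l ^ 4 \<le> 8 * N ^ 2 / real l ^ 2"
      using L(4)[OF that] by (intro divide_left_mono power_increasing mult_pos_pos) auto
    moreover have "real (card (T l)) \<le> 8 * N ^ 2 / real l ^ 4 + 4 * N"
      using card_famC_tail(1)[OF L(1,2)[OF that] N] by (simp add: T_def algebra_simps power2_eq_square)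
    ultimately show ?thesis using P by simp
  qed
  have "P \<subseteq> {1..nat \<lfloor>2 * sqrt N\<rfloor>}"
    by (auto simp: P_def L_def le_nat_floor)
  hence "card P \<le> nat \<lfloor>2 * sqrt N\<rfloor>" using card_mono[of "{1..nat \<lfloor>2 * sqrt N\<rfloor>}" P] by simp
  moreover have "sqrt N \<ge> 0" using N by simp
  ultimately have cP: "real (card P) \<le> 2 * sqrt N" by linarith
  have "L \<subseteq> {1..n}" by (auto simp: L_def)
  hence "card L \<le> n" using card_mono[of "{1..n}" L] by simp
  hence cL: "real (card L) \<le> 4 * N" using N unfolding n_def by linarith
  have S: "(\<Sum>l\<in>L. 1 / real l ^ 2) \<le> 1 / real z"
  proof -
    have "(\<Sum>l\<in>L. 1 / real l ^ 2) \<le> (\<Sum>l\<in>{z<..n}. 1 / real l ^ 2)"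
      by (intro sum_mono2) (auto simp: L_def)
    thus ?thesis using sum_inverse_squares_le[of z n] z by simp
  qed
  have "card (large_prime_exceptions z N) \<le> card (\<Union>l\<in>L. G l \<union> T l)"
    using sub fin finL by (intro card_mono) auto
  also have "\<dots> \<le> (\<Sum>l\<in>L. card (G l \<union> T l))" by (rule card_UN_le[OF finL])
  also have "\<dots> \<le> (\<Sum>l\<in>L. card (G l) + card (T l))" by (intro sum_mono card_Un_le)
  finally have "real (card (large_prime_exceptions z N)) \<le> real (\<Sum>l\<in>L. card (G l) + card (T l))"
    by (simp only: of_nat_le_iff)
  also have "\<dots> = (\<Sum>l\<in>L. real (card (G l)) + real (card (T l)))" by simp
  also have "\<dots> \<le> (\<Sum>l\<in>L. 3 * N ^ 2 * (1 / real l ^ 2) + (8 * N ^ 2 * (1 / real l ^ 2) + (if l \<in> P then 4 * N else 0) + 4))"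
    using card_both_dvd(1)[OF L(4) N] bound by (intro sum_mono add_mono) (auto simp: G_def)
  also have "\<dots> = (\<Sum>l\<in>L. 11 * N ^ 2 * (1 / real l ^ 2)) + (\<Sum>l\<in>L. if l \<in> P then 4 * N else 0) + (\<Sum>l\<in>L. 4)"
    unfolding sum.distrib [symmetric] by (intro sum.cong refl) (simp add: algebra_simps)
  also have "\<dots> = 11 * N ^ 2 * (\<Sum>l\<in>L. 1 / real l ^ 2) + 4 * N * real (card P) + 4 * real (card L)"
  proof -
    have "L \<inter> P = P" by (auto simp: P_def)
    thus ?thesis using finL by (simp add: sum_distrib_left sum.If_cases)
  qed
  also have "\<dots> \<le> 11 * N ^ 2 * (1 / real z) + 4 * N * (2 * sqrt N) + 4 * (4 * N)"
    using S cP cL N by (intro add_mono mult_left_mono) auto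
  finally show ?thesis by simp
qed

section \<open>The sieve\<close>

abbreviation "A_bound \<equiv> 4 powr (- 1 / 3) :: real"
abbreviation "B_bound \<equiv> 27 powr (- 1 / 2) :: real"

lemma A_bound_properties: "A_bound ^ 3 = 1 / 4" "A_bound \<le> 1" "1 / 2 \<le> A_bound"
proof -
  have "A_bound ^ 3 = 4 powr (- 1 / 3 + (- 1 / 3 + - 1 / 3))"
    by (simp only: powr_add power3_eq_cube mult.assoc)
  thus "A_bound ^ 3 = 1 / 4" by (simp add: powr_minus_divide)
  have "4 powr (- 1 / 3) \<le> (4 powr 0 :: real)" by (intro powr_mono) auto
  thus "A_bound \<le> 1" by simp
  have "4 powr (- 1 / 2) = (1 / 2 :: real)"
    by (simp add: powr_minus_divide powr_half_sqrt)
  moreover have "4 powr (- 1 / 2) \<le> (4 powr (- 1 / 3) :: real)" by (intro powr_mono) auto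
  ultimately show "1 / 2 \<le> A_bound" by (simp only:)
qed

lemma B_bound_properties: "B_bound ^ 2 = 1 / 27" "1 / 27 \<le> B_bound"
proof -
  have "B_bound ^ 2 = 27 powr (- 1 / 2 + - 1 / 2)"
    by (simp only: powr_add power2_eq_square)
  thus "B_bound ^ 2 = 1 / 27" by (simp add: powr_minus_divide)
  have "27 powr (- 1) \<le> (27 powr (- 1 / 2) :: real)" by (intro powr_mono) auto
  thus "1 / 27 \<le> B_bound" by (simp add: powr_minus_divide)
qed

lemma fam_mult: "famA (c * a) (c * b) = c ^ 8 * famA a b" "famB (c * a) (c * b) = c ^ 12 * famB a b"
  unfolding fam_factors famC_mult by (simp_all add: power_mult_distrib algebra_simps)

lemma fam_of_int: "famA (of_int a) (of_int b) = of_int (famA a b)" "famB (of_int a) (of_int b) = of_int (famB a b)"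
  by (simp_all add: famA_def famB_def famC_def)

lemma continuous_on_fam [continuous_intros]:
  fixes f g :: "'a :: topological_space \<Rightarrow> real"
  assumes "continuous_on S f" "continuous_on S g"
  shows "continuous_on S (\<lambda>x. famA (f x) (g x))" "continuous_on S (\<lambda>x. famB (f x) (g x))"
  unfolding famA_def famB_def famC_def by (intro continuous_intros assms)+

text \<open>The bound on \<open>famA\<close> alone confines the region. Up to sign
  \<open>famA\<close> is a product of two forms with positive coefficients, each at least
  \<open>u ^ 4 + v ^ 4\<close>, so
  \<open>(u ^ 4 + v ^ 4) ^ 2 \<le> \<bar>famA u v\<bar> \<le> 1\<close>.\<close>

lemma region_subset_unit:
  assumes "(u, v) \<in> region"
  shows "\<bar>u\<bar> \<le> 1" "0 < v" "v \<le> 1"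
proof -
  have v: "v > 0" and A: "\<bar>famA u v\<bar> \<le> 1"
    using assms A_bound_properties(2) by (auto simp: region_def)
  have "0 \<le> u ^ 4" "0 \<le> v ^ 4" "0 \<le> u ^ 2 * v ^ 2" by auto
  then obtain p q r where pqr: "p = u ^ 4" "q = v ^ 4" "r = u ^ 2 * v ^ 2" and nonneg: "0 \<le> p" "0 \<le> q" "0 \<le> r"
    by blast
  have "- famA u v = 3 * (p + 10 * r + 5 * q) * (p + 22 * r + 125 * q)"
    by (simp add: fam_factors famC_def pqr algebra_simps)
  moreover have "p + q \<le> 3 * (p + 10 * r + 5 * q)" "p + q \<le> p + 22 * r + 125 * q" "0 \<le> p + q"
    using nonneg by simp_all
  hence "(p + q) * (p + q) \<le> 3 * (p + 10 * r + 5 * q) * (p + 22 * r + 125 * q)"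
    by (meson mult_mono order_trans)
  ultimately have "(p + q) ^ 2 \<le> 1 ^ 2" using A by (simp add: power2_eq_square)
  hence "p + q \<le> 1" by (rule power2_le_imp_le) simp
  hence "p \<le> 1" "q \<le> 1" using nonneg by linarith+
  hence "\<bar>u\<bar> ^ 4 \<le> 1 ^ 4" "v ^ 4 \<le> 1 ^ 4" by (simp_all add: power_even_abs pqr)
  thus "\<bar>u\<bar> \<le> 1" "0 < v" "v \<le> 1" using v by (auto intro: power_le_imp_le_base[of _ 3] simp del: power_one)
qed

lemma bounded_region: "bounded region"
proof (rule bounded_subset)
  show "region \<subseteq> cbox (- 1, - 1) (1, 1)"
    using region_subset_unit by (force simp: cbox_Pair_eq abs_le_iff)
qed (rule bounded_cbox)

lemma region_eq: "region = {p. snd p > 0} \<inter> ({p. \<bar>famA (fst p) (snd p)\<bar> \<le> A_bound} \<inter> {p. \<bar>famB (fst p) (snd p)\<bar> \<le> B_bound})"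
  by (auto simp: region_def)

lemma open_closed_bounds:
  "open {p :: real \<times> real. snd p > 0}" "closed {p :: real \<times> real. snd p \<ge> 0}"
  "closed {p. \<bar>famA (fst p) (snd p)\<bar> \<le> c}" "closed {p. \<bar>famB (fst p) (snd p)\<bar> \<le> c}"
  "open {p. \<bar>famA (fst p) (snd p)\<bar> < c}" "open {p. \<bar>famB (fst p) (snd p)\<bar> < c}"
  "closed {p. \<bar>famA (fst p) (snd p)\<bar> = c}" "closed {p. \<bar>famB (fst p) (snd p)\<bar> = c}"
  for c :: real
  by (intro open_Collect_less closed_Collect_le closed_Collect_eq continuous_intros)+

lemma region_borel: "region \<in> sets borel"
  unfolding region_eq by (intro sets.Int borel_open borel_closed open_closed_bounds)

text \<open>By homogeneity a ray from the origin meets a nonzero level of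
  \<open>\<bar>f\<bar>\<close> at most once, which is the criterion of
  \<open>starlike_negligible\<close>.\<close>

lemma negligible_homogeneous_level:
  fixes f :: "real \<times> real \<Rightarrow> real"
  assumes hom: "\<And>t p. f (t *\<^sub>R p) = t ^ n * f p" and "n > 0" "c \<noteq> 0" "closed {p. \<bar>f p\<bar> = c}"
  shows "negligible {p. \<bar>f p\<bar> = c}"
proof (rule starlike_negligible[OF assms(4), of 0])
  fix t and p :: "real \<times> real"
  assume h: "0 + t *\<^sub>R p \<in> {p. \<bar>f p\<bar> = c}" "0 \<le> t" "0 + p \<in> {p. \<bar>f p\<bar> = c}"
  hence "t ^ n * c = c" by (simp add: hom abs_mult)
  hence "t ^ n = 1" using \<open>c \<noteq> 0\<close> by simp
  thus "t = 1" using power_eq_1_iff[of t n] h(2) \<open>n > 0\<close> by simp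
qed

lemma negligible_frontier_region: "negligible (frontier region)"
proof (rule negligible_subset)
  let ?A = "\<lambda>p. famA (fst p) (snd p) :: real" and ?B = "\<lambda>p. famB (fst p) (snd p) :: real"
  let ?Z = "{p :: real \<times> real. (0, 1) \<bullet> p = 0}"
  show "negligible (?Z \<union> ({p. \<bar>?A p\<bar> = A_bound} \<union> {p. \<bar>?B p\<bar> = B_bound}))"
  proof (intro negligible_Un)
    show "negligible ?Z" by (rule negligible_hyperplane) (simp add: zero_prod_def)
    show "negligible {p. \<bar>?A p\<bar> = A_bound}"
      by (rule negligible_homogeneous_level[of _ 8]) (simp_all add: fam_mult open_closed_bounds)
    show "negligible {p. \<bar>?B p\<bar> = B_bound}"
      by (rule negligible_homogeneous_level[of _ 12]) (simp_all add: fam_mult open_closed_bounds)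
  qed
  show "frontier region \<subseteq> ?Z \<union> ({p. \<bar>?A p\<bar> = A_bound} \<union> {p. \<bar>?B p\<bar> = B_bound})"
  proof
    fix p assume p: "p \<in> frontier region"
    let ?O = "{p. snd p > 0} \<inter> ({p. \<bar>?A p\<bar> < A_bound} \<inter> {p. \<bar>?B p\<bar> < B_bound})"
    let ?C = "{p. snd p \<ge> 0} \<inter> ({p. \<bar>?A p\<bar> \<le> A_bound} \<inter> {p. \<bar>?B p\<bar> \<le> B_bound})"
    have "?O \<subseteq> interior region"
      by (intro interior_maximal open_Int open_closed_bounds) (auto simp: region_eq)
    moreover have "closure region \<subseteq> ?C"
      by (intro closure_minimal closed_Int open_closed_bounds) (auto simp: region_eq)
    ultimately have "p \<in> ?C" "p \<notin> ?O" using p by (auto simp: frontier_def)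
    thus "p \<in> ?Z \<union> ({p. \<bar>?A p\<bar> = A_bound} \<union> {p. \<bar>?B p\<bar> = B_bound})"
      by (cases p) auto
  qed
qed

lemma measure_region_pos: "measure lborel region > 0"
proof -
  let ?A = "\<lambda>p. famA (fst p) (snd p) :: real" and ?B = "\<lambda>p. famB (fst p) (snd p) :: real"
  let ?O = "{p. snd p > 0} \<inter> ({p. \<bar>?A p\<bar> < A_bound} \<inter> {p. \<bar>?B p\<bar> < B_bound})"
  \<comment> \<open>Any point close enough to the origin in the open upper half-plane would do: both
    forms are small there.\<close>
  have "(0, 1 / 10) \<in> ?O"
    using A_bound_properties(3) B_bound_properties(2) by (simp add: famA_def famB_def famC_def power_divide)
  moreover have "open ?O" by (intro open_Int open_closed_bounds)
  ultimately have "\<not> negligible ?O" using open_not_negligible by blast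
  moreover have "?O \<subseteq> region" by (auto simp: region_eq)
  ultimately have "\<not> negligible region" using negligible_subset by blast
  hence "emeasure lebesgue region \<noteq> 0"
    using region_borel by (simp add: negligible_iff_null_sets null_sets_def)
  hence "emeasure lborel region \<noteq> 0" using region_borel by simp
  moreover have "emeasure lborel region < \<infinity>"
    by (rule emeasure_bounded_finite[OF bounded_region])
  ultimately show ?thesis
    by (simp add: measure_def enn2real_positive_iff zero_less_iff_neq_zero)
qed

lemma mem_region_iff_height:
  assumes "Y > 0"
  shows "(of_int a / Y, of_int b / Y) \<in> region \<longleftrightarrow>
    b > 0 \<and> of_int (model_height (famA a b) (famB a b)) \<le> Y ^ 24"
proof -
  have scale: "famA (of_int a / Y) (of_int b / Y) = of_int (famA a b) / Y ^ 8"
    "famB (of_int a / Y) (of_int b / Y) = of_int (famB a b) / Y ^ 12"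
    using fam_mult[of "1 / Y" "of_int a" "of_int b"] by (simp_all add: fam_of_int power_divide)
  have A: "\<bar>x\<bar> / Y ^ 8 \<le> A_bound \<longleftrightarrow> 4 * \<bar>x\<bar> ^ 3 \<le> Y ^ 24" for x :: real
  proof -
    have "\<bar>x\<bar> / Y ^ 8 \<le> A_bound \<longleftrightarrow> (\<bar>x\<bar> / Y ^ 8) ^ 3 \<le> A_bound ^ 3"
      using assms by (subst power_mono_iff) auto
    also have "\<dots> \<longleftrightarrow> 4 * \<bar>x\<bar> ^ 3 \<le> Y ^ 24"
      unfolding A_bound_properties(1) using assms by (simp add: power_divide divide_le_eq mult.commute flip: power_mult)
    finally show ?thesis .
  qed
  have B: "\<bar>x\<bar> / Y ^ 12 \<le> B_bound \<longleftrightarrow> 27 * \<bar>x\<bar> ^ 2 \<le> Y ^ 24" for x :: real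
  proof -
    have "\<bar>x\<bar> / Y ^ 12 \<le> B_bound \<longleftrightarrow> (\<bar>x\<bar> / Y ^ 12) ^ 2 \<le> B_bound ^ 2"
      using assms by (subst power_mono_iff) auto
    also have "\<dots> \<longleftrightarrow> 27 * \<bar>x\<bar> ^ 2 \<le> Y ^ 24"
      unfolding B_bound_properties(1) using assms by (simp add: power_divide divide_le_eq mult.commute flip: power_mult)
    finally show ?thesis .
  qed
  have "\<bar>of_int (famA a b) / Y ^ 8\<bar> = \<bar>of_int (famA a b)\<bar> / Y ^ 8"
    "\<bar>of_int (famB a b) / Y ^ 12\<bar> = \<bar>of_int (famB a b)\<bar> / Y ^ 12"
    using assms by (simp_all add: abs_divide)
  thus ?thesis
    unfolding region_def mem_Collect_eq prod.case scale model_height_def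
    using assms A[of "of_int (famA a b)"] B[of "of_int (famB a b)"]
    by (auto simp: of_int_max zero_less_divide_iff)
qed

lemma mem_region_lattice_box:
  assumes "(of_int a / Y, of_int b / Y) \<in> region" "Y > 0"
  shows "(a, b) \<in> lattice_box Y"
  using region_subset_unit[OF assms(1)] assms(2) by (simp add: lattice_box_def abs_divide field_simps)

section \<open>Comparison of the finite sieve with the minimal points\<close>

definition small_primes :: "nat \<Rightarrow> nat set" where
  "small_primes z = {l \<in> {..z}. Factorial_Ring.prime l}"

definition sieved :: "nat \<Rightarrow> real \<Rightarrow> (int \<times> int) set" where
  "sieved z Y = {(a, b). (\<forall>l\<in>small_primes z. good (int l) a b) \<and> (of_int a / Y, of_int b / Y) \<in> region}"

lemma sieved_tendsto:
  "((\<lambda>Y. real (card (sieved z Y)) / Y ^ 2) \<longlongrightarrow>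
    (\<Prod>l\<in>small_primes z. local_density l) * measure lborel region) at_top"
proof -
  let ?L = "small_primes z"
  let ?M = "\<Prod>l\<in>?L. int l ^ 6"
  have fin: "finite ?L" by (simp add: small_primes_def)
  have primes: "Factorial_Ring.prime l" if "l \<in> ?L" for l using that by (simp add: small_primes_def)
  have M: "?M > 0" using primes by (intro prod_pos) (simp add: prime_gt_0_nat)
  have "real (residue_count ?M (\<lambda>a b. \<forall>l\<in>?L. good (int l) a b)) / of_int ?M ^ 2
      = (\<Prod>l\<in>?L. local_density l)"
    using residue_count_good_primes[OF fin primes]
    by (simp add: local_density_eq prod_dividef flip: prod_power_distrib power_mult)
  thus ?thesis
    using periodic_count_tendsto[OF bounded_region region_borel negligible_frontier_region M
      residue_count_good_primes[OF fin primes, THEN conjunct1]]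
    by (simp add: sieved_def)
qed

definition minimal_points :: "real \<Rightarrow> (int \<times> int) set" where
  "minimal_points Y = {(a, b). b > 0 \<and> gcd a b = 1 \<and> 4 * famA a b ^ 3 + 27 * famB a b ^ 2 \<noteq> 0 \<and>
     minimal_pair (famA a b) (famB a b) \<and> (of_int a / Y, of_int b / Y) \<in> region}"

lemma N2_eq: "Y > 0 \<Longrightarrow> N2 (Y ^ 24) = card (minimal_points Y)"
  unfolding N2_def minimal_points_def by (intro arg_cong[where f = card]) (auto simp: mem_region_iff_height)

lemma minimal_points_subset_sieved: "minimal_points Y \<subseteq> sieved z Y"
proof
  fix q assume q: "q \<in> minimal_points Y"
  obtain a b where ab: "q = (a, b)" by (cases q)
  have h: "coprime a b" "minimal_pair (famA a b) (famB a b)" "(of_int a / Y, of_int b / Y) \<in> region"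
    using q by (auto simp: minimal_points_def ab coprime_iff_gcd_eq_1)
  have "good (int l) a b" if "l \<in> small_primes z" for l
  proof -
    have l: "int l > 1" using that by (auto simp: small_primes_def dest: prime_gt_1_nat)
    have "\<not> (int l dvd a \<and> int l dvd b)"
    proof
      assume "int l dvd a \<and> int l dvd b"
      hence "is_unit (int l)" using h(1) by (meson coprime_common_divisor)
      thus False using l by simp
    qed
    thus ?thesis using l h(2) by (auto simp: good_def minimal_pair_def)
  qed
  thus "q \<in> sieved z Y" using h by (simp add: sieved_def ab)
qed

text \<open>A sieved point that is not counted fails at a prime above \<open>z\<close> or gives a
  singular curve. In the first case \<open>z \<ge> 5\<close> makes \<open>good_iff\<close>
  available, so the failure is one of the two in \<open>large_prime_exceptions\<close>. In the
  second case \<open>a = 0\<close>, and coprimality with \<open>b > 0\<close> leaves only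
  \<open>(0, 1)\<close>.\<close>

lemma sieved_subset:
  assumes z: "z \<ge> 5" and Y: "Y > 0"
  shows "sieved z Y \<subseteq> minimal_points Y \<union> large_prime_exceptions z Y \<union> {(0, 1)}"
proof
  fix q assume q: "q \<in> sieved z Y"
  obtain a b where ab: "q = (a, b)" by (cases q)
  have region: "(of_int a / Y, of_int b / Y) \<in> region"
    and small: "\<And>l. Factorial_Ring.prime l \<Longrightarrow> l \<le> z \<Longrightarrow> good (int l) a b"
    using q by (auto simp: sieved_def ab small_primes_def)
  have box: "(a, b) \<in> lattice_box Y" using mem_region_lattice_box[OF region Y] .
  hence b: "b > 0" by (simp add: lattice_box_def)
  have large: "l > z" if "Factorial_Ring.prime l" "\<not> good (int l) a b" for l
    using small[OF that(1)] that(2) by force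
  show "q \<in> minimal_points Y \<union> large_prime_exceptions z Y \<union> {(0, 1)}"
  proof (cases "coprime a b")
    case False
    hence "\<not> is_unit (gcd a b)" by (simp add: coprime_iff_gcd_eq_1)
    moreover have "gcd a b \<noteq> 0" using b by simp
    ultimately obtain p where p: "Factorial_Ring.prime p" "p dvd gcd a b"
      using prime_divisor_exists by blast
    obtain l where l: "p = int l" "Factorial_Ring.prime l"
      using p(1) by (metis prime_ge_0_int prime_int_nat_transfer zero_le_imp_eq_int prime_nat_int_transfer)
    have dvd: "int l dvd a \<and> int l dvd b" using p(2) l by simp
    hence "l > z" using large[OF l(2)] by (simp add: good_def)
    thus ?thesis using box dvd l(2) by (auto simp: large_prime_exceptions_def ab)
  next
    case cop: True
    show ?thesis
    proof (cases "a = 0 \<or> minimal_pair (famA a b) (famB a b)")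
      case True
      show ?thesis
      proof (cases "a = 0")
        case True
        thus ?thesis using cop b by (simp add: ab)
      next
        case False
        hence "4 * famA a b ^ 3 + 27 * famB a b ^ 2 \<noteq> 0"
          using famC_pos[of b a] b unfolding fam_discriminant by simp
        thus ?thesis
          using True False cop b region by (simp add: minimal_points_def ab coprime_iff_gcd_eq_1)
      qed
    next
      case False
      then obtain m where m: "m > 1" "m ^ 4 dvd famA a b" "m ^ 6 dvd famB a b"
        by (auto simp: minimal_pair_def)
      then obtain p where p: "Factorial_Ring.prime p" "p dvd m"
        using prime_divisor_exists[of m] by auto
      obtain l where l: "p = int l" "Factorial_Ring.prime l"
        using p(1) by (metis prime_ge_0_int prime_int_nat_transfer zero_le_imp_eq_int prime_nat_int_transfer)
      have "int l ^ 4 dvd famA a b" "int l ^ 6 dvd famB a b"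
        using m p l dvd_trans[OF dvd_power_same] by blast+
      hence bad: "\<not> good (int l) a b" by (simp add: good_def)
      hence lz: "l > z" using large l(2) by blast
      have "\<not> (int l dvd a \<and> int l dvd b)"
        using cop p(1) l(1) by (metis coprime_common_divisor not_prime_unit)
      hence "int l ^ 4 dvd famC a b"
        using bad good_iff[of "int l" a b] l(2) lz z by auto
      thus ?thesis using box cop l(2) lz by (auto simp: large_prime_exceptions_def ab)
    qed
  qed
qed

lemma card_minimal_points_bounds:
  assumes z: "z \<ge> 5" and Y: "Y \<ge> 1"
  shows "real (card (minimal_points Y)) \<le> real (card (sieved z Y))"
    "real (card (sieved z Y)) \<le> real (card (minimal_points Y)) + (11 * Y ^ 2 / real z + 8 * (Y * sqrt Y) + 16 * Y) + 1"
proof -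
  have Y0: "Y > 0" using Y by simp
  have "sieved z Y \<subseteq> lattice_box Y"
    using mem_region_lattice_box[OF _ Y0] by (auto simp: sieved_def)
  hence fin: "finite (sieved z Y)" using finite_lattice_box finite_subset by blast
  show "real (card (minimal_points Y)) \<le> real (card (sieved z Y))"
    using card_mono[OF fin minimal_points_subset_sieved] by simp
  have fin': "finite (minimal_points Y)" using finite_subset[OF minimal_points_subset_sieved fin] .
  have "large_prime_exceptions z Y \<subseteq> lattice_box Y" by (auto simp: large_prime_exceptions_def)
  hence fin'': "finite (large_prime_exceptions z Y)" using finite_lattice_box finite_subset by blast
  have "card (sieved z Y) \<le> card (minimal_points Y \<union> large_prime_exceptions z Y \<union> {(0, 1)})"
    using fin' fin'' by (intro card_mono sieved_subset[OF z Y0]) auto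
  also have "\<dots> \<le> card (minimal_points Y) + card (large_prime_exceptions z Y) + 1"
    by (rule order_trans[OF card_Un_le]) (simp add: card_Un_le)
  finally show "real (card (sieved z Y)) \<le> real (card (minimal_points Y)) + (11 * Y ^ 2 / real z + 8 * (Y * sqrt Y) + 16 * Y) + 1"
    using card_large_prime_exceptions[OF z Y] by linarith
qed

section \<open>The Euler product and the limit\<close>

abbreviation euler_term :: "nat \<Rightarrow> real" where
  "euler_term l \<equiv> if Factorial_Ring.prime l \<and> l \<notin> {2, 3, 5} then euler_factor l else 1"

text \<open>With at most four roots, the two corrections are at most \<open>1 / l ^ 2\<close> and
  \<open>4 / l ^ 4\<close>, together at most \<open>5 / l ^ 2\<close>. For \<open>l \<ge> 6\<close>
  this is below 1, whence positivity.\<close>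

lemma euler_factor_bounds:
  assumes "Factorial_Ring.prime l" "l \<notin> {2, 3, 5}"
  shows "\<bar>euler_factor l - 1\<bar> \<le> 5 * inverse (real l ^ 2)" "euler_factor l > 0"
proof -
  have "l \<noteq> 0" "l \<noteq> 1" "l \<noteq> 4" using assms(1) prime_nat_iff[of 4] by (auto dest: spec[of _ 2])
  hence l: "l \<ge> 6" using assms(2) by auto
  have "real (root_count l) * (real l - 1) / real l ^ 5 \<le> 4 * real l / real l ^ 5"
    using root_count_le_4[OF assms(1)] l by (intro divide_right_mono mult_mono) auto
  also have "\<dots> = 4 / real l ^ 4" using l by (simp add: field_simps eval_nat_numeral)
  also have "\<dots> \<le> 4 / real l ^ 2" using l by (intro divide_left_mono power_increasing mult_pos_pos) auto
  finally have le: "real (root_count l) * (real l - 1) / real l ^ 5 \<le> 4 / real l ^ 2" .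
  have ge: "0 \<le> real (root_count l) * (real l - 1) / real l ^ 5" using l by simp
  show "\<bar>euler_factor l - 1\<bar> \<le> 5 * inverse (real l ^ 2)"
    using le ge by (simp add: euler_factor_def divide_inverse)
  have "6 ^ 2 \<le> real l ^ 2" using l by (intro power_mono) auto
  hence "5 / real l ^ 2 \<le> 5 / 6 ^ 2" using l by (intro divide_left_mono) auto
  thus "euler_factor l > 0" using le by (simp add: euler_factor_def)
qed

lemma convergent_prod_euler: "convergent_prod euler_term"
proof (rule abs_convergent_prod_imp_convergent_prod, rule summable_imp_abs_convergent_prod)
  show "summable (\<lambda>l. norm (euler_term l - 1))"
  proof (rule summable_comparison_test)
    show "\<exists>N. \<forall>n\<ge>N. norm (norm (euler_term n - 1)) \<le> 5 * inverse (real n ^ 2)"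
      using euler_factor_bounds(1) by auto
    show "summable (\<lambda>n. 5 * inverse (real n ^ 2))"
      by (intro summable_mult inverse_power_summable) auto
  qed
qed

lemma local_density_pos:
  assumes "l \<in> {2, 3, 5}"
  shows "local_density l > 0"
proof -
  \<comment> \<open>At \<open>(1, 0)\<close> the values of \<open>famA\<close> and
    \<open>famB\<close> are \<open>- 3\<close> and 2, divisible by no fourth and no sixth power of a
    prime.\<close>
  have "good (int l) 1 0" using assms by (auto simp: good_def famA_def famB_def famC_def)
  hence "{(1, 0)} \<subseteq> {(a, b) \<in> {0..<int l ^ 6} \<times> {0..<int l ^ 6}. good (int l) a b}"
    using assms by auto
  moreover have "finite {(a, b) \<in> {0..<int l ^ 6} \<times> {0..<int l ^ 6}. good (int l) a b}"
    by (rule finite_subset[of _ "{0..<int l ^ 6} \<times> {0..<int l ^ 6}"]) auto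
  ultimately have "residue_count (int l ^ 6) (good (int l)) \<ge> card {(1 :: int, 0 :: int)}"
    unfolding residue_count_def by (rule card_mono[rotated])
  thus ?thesis using assms by (auto simp: local_density_eq)
qed

text \<open>The asymptotic equivalence is proved by dividing by this constant. Absolute convergence
  with nonzero factors keeps the infinite product away from 0.\<close>

lemma leading_constant_neq_0: "leading_constant \<noteq> 0"
proof -
  have "euler_term l \<noteq> 0" for l using euler_factor_bounds(2)[of l] by auto
  hence "(\<Prod>l. euler_term l) \<noteq> 0" using prodinf_nonzero[OF convergent_prod_euler] by blast
  thus ?thesis
    using local_density_pos[of 2] local_density_pos[of 3] local_density_pos[of 5] measure_region_pos
    by (simp add: leading_constant_def)
qed

lemma local_density_prod_tendsto:
  "(\<lambda>z. (\<Prod>l\<in>small_primes z. local_density l) * measure lborel region) \<longlonglongrightarrow> leading_constant"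
proof -
  let ?c = "local_density 2 * local_density 3 * local_density 5"
  have "(\<lambda>z. ?c * (\<Prod>l\<le>z. euler_term l) * measure lborel region) \<longlonglongrightarrow> leading_constant"
    unfolding leading_constant_def
    by (intro tendsto_mult tendsto_const convergent_prod_LIMSEQ convergent_prod_euler)
  moreover have "\<forall>\<^sub>F z in sequentially. ?c * (\<Prod>l\<le>z. euler_term l) * measure lborel region =
      (\<Prod>l\<in>small_primes z. local_density l) * measure lborel region"
    using eventually_ge_at_top[of 5]
  proof eventually_elim
    case (elim z)
    let ?Q = "{l \<in> {..z}. Factorial_Ring.prime l \<and> l \<notin> {2, 3, 5}}"
    have "Factorial_Ring.prime (3 :: nat)" "Factorial_Ring.prime (5 :: nat)"
      by (simp_all add: prime_nat_numeral_eq)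
    hence "small_primes z = {2, 3, 5} \<union> ?Q"
      using elim two_is_prime_nat by (auto simp: small_primes_def)
    hence "(\<Prod>l\<in>small_primes z. local_density l) = (\<Prod>l\<in>{2, 3, 5}. local_density l) * (\<Prod>l\<in>?Q. local_density l)"
      by (simp only:) (rule prod.union_disjoint, auto)
    also have "(\<Prod>l\<in>?Q. local_density l) = (\<Prod>l\<in>?Q. euler_factor l)"
      by (intro prod.cong refl local_density_eq_euler_factor) auto
    also have "\<dots> = (\<Prod>l\<le>z. euler_term l)"
      by (rule prod.inter_filter) simp
    finally show ?case by simp
  qed
  ultimately show ?thesis by (rule Lim_transform_eventually)
qed

text \<open>First \<open>z\<close> is fixed so that the finite product is near its limit and the
  tail \<open>11 / z\<close> is small; only then does \<open>Y\<close> grow. The four quarters of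
  \<open>e\<close> are these two errors, the error of the sieve for this \<open>z\<close>, and the
  lower-order terms of the tail.\<close>

lemma minimal_points_tendsto:
  "((\<lambda>Y. real (card (minimal_points Y)) / Y ^ 2) \<longlongrightarrow> leading_constant) at_top"
proof (rule tendstoI)
  fix e :: real assume e: "e > 0"
  let ?D = "\<lambda>z. (\<Prod>l\<in>small_primes z. local_density l) * measure lborel region"
  have "\<forall>\<^sub>F z in sequentially. dist (?D z) leading_constant < e / 4"
    using local_density_prod_tendsto e by (intro tendstoD) auto
  moreover have "(\<lambda>z. 11 / real z) \<longlonglongrightarrow> 0"
    by (rule lim_const_over_n)
  hence "\<forall>\<^sub>F z in sequentially. dist (11 / real z) 0 < e / 4"
    using e by (intro tendstoD) auto
  moreover note eventually_ge_at_top[of 5]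
  ultimately have "\<forall>\<^sub>F z in sequentially. \<bar>?D z - leading_constant\<bar> < e / 4 \<and> 11 / real z < e / 4 \<and> z \<ge> 5"
    by eventually_elim (simp add: dist_real_def)
  then obtain z where z: "\<bar>?D z - leading_constant\<bar> < e / 4" "11 / real z < e / 4" "z \<ge> 5"
    unfolding eventually_sequentially by blast
  have "\<forall>\<^sub>F Y in at_top. dist (real (card (sieved z Y)) / Y ^ 2) (?D z) < e / 4"
    using sieved_tendsto[of z] e by (intro tendstoD) auto
  moreover have "((\<lambda>Y :: real. (8 * (Y * sqrt Y) + 16 * Y + 1) / Y ^ 2) \<longlongrightarrow> 0) at_top"
    by real_asymp
  hence "\<forall>\<^sub>F Y :: real in at_top. dist ((8 * (Y * sqrt Y) + 16 * Y + 1) / Y ^ 2) 0 < e / 4"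
    using e by (intro tendstoD) auto
  ultimately show "\<forall>\<^sub>F Y in at_top. dist (real (card (minimal_points Y)) / Y ^ 2) leading_constant < e"
    using eventually_ge_at_top[of 1]
  proof eventually_elim
    case (elim Y)
    let ?m = "real (card (minimal_points Y)) / Y ^ 2" and ?s = "real (card (sieved z Y)) / Y ^ 2"
    have Y2: "Y ^ 2 > 0" using elim by simp
    have "?m \<le> ?s"
      using card_minimal_points_bounds(1)[OF z(3) elim(3)] by (intro divide_right_mono) auto
    moreover have "?s \<le> (real (card (minimal_points Y)) + (11 * Y ^ 2 / real z + 8 * (Y * sqrt Y) + 16 * Y) + 1) / Y ^ 2"
      using card_minimal_points_bounds(2)[OF z(3) elim(3)] by (intro divide_right_mono) auto
    moreover have "\<dots> = ?m + 11 / real z + (8 * (Y * sqrt Y) + 16 * Y + 1) / Y ^ 2"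
      using Y2 by (simp add: add_divide_distrib)
    ultimately have "?m \<le> ?s" "?s \<le> ?m + 11 / real z + (8 * (Y * sqrt Y) + 16 * Y + 1) / Y ^ 2"
      by linarith+
    thus ?case using elim(1,2) z(1,2) unfolding dist_real_def by linarith
  qed
qed

lemma N2_asymp_equiv: "(\<lambda>x. real (N2 x)) \<sim>[at_top] (\<lambda>x. leading_constant * x powr (1 / 12))"
proof (rule asymp_equivI')
  have "filterlim (\<lambda>x :: real. x powr (1 / 24)) at_top at_top" by real_asymp
  hence "((\<lambda>x. real (card (minimal_points (x powr (1 / 24)))) / (x powr (1 / 24)) ^ 2) \<longlongrightarrow> leading_constant) at_top"
    by (rule filterlim_compose[OF minimal_points_tendsto])
  hence "((\<lambda>x. real (card (minimal_points (x powr (1 / 24)))) / (x powr (1 / 24)) ^ 2 / leading_constant)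
      \<longlongrightarrow> leading_constant / leading_constant) at_top"
    by (intro tendsto_divide tendsto_const leading_constant_neq_0)
  moreover have "\<forall>\<^sub>F x in at_top. real (card (minimal_points (x powr (1 / 24)))) / (x powr (1 / 24)) ^ 2 / leading_constant =
      real (N2 x) / (leading_constant * x powr (1 / 12))"
    using eventually_gt_at_top[of 0]
  proof eventually_elim
    case (elim x)
    have "(x powr (1 / 24)) ^ 24 = x" "(x powr (1 / 24)) ^ 2 = x powr (1 / 12)"
      using elim by (simp_all add: powr_power)
    thus ?case using N2_eq[of "x powr (1 / 24)"] elim by (simp add: mult.commute)
  qed
  ultimately show "((\<lambda>x. real (N2 x) / (leading_constant * x powr (1 / 12))) \<longlongrightarrow> 1) at_top"
    using Lim_transform_eventually leading_constant_neq_0 by force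
qed

section \<open>Twists of the curve with complex multiplication by the Gaussian integers\<close>

lemma to_ac_inject: "to_ac x = to_ac y \<longleftrightarrow> x = (y :: 'a :: field)"
proof
  assume "to_ac x = to_ac y"
  hence "to_ac (x - y) = 0" by simp
  moreover have "to_ac (x - y) * to_ac (inverse (x - y)) = 1" if "x \<noteq> y"
    using that by (metis right_inverse right_minus_eq to_ac_1 to_ac_mult)
  ultimately show "x = y" by auto
qed simp

lemma qbar_numeral_neq_0 [simp]: "(numeral n :: qbar) \<noteq> 0"
  using to_ac_inject[of "numeral n :: rat" 0] by simp

lemma field_qbar_ring: "field qbar_ring"
  by (rule field_from_type_algebra)

lemma qbar_ring_simps:
  "carrier qbar_ring = UNIV" "x \<otimes>\<^bsub>qbar_ring\<^esub> y = x * y" "x \<oplus>\<^bsub>qbar_ring\<^esub> y = x + y"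
  "\<one>\<^bsub>qbar_ring\<^esub> = 1" "\<zero>\<^bsub>qbar_ring\<^esub> = 0"
  by (simp_all add: ring_of_type_algebra_def)

lemma qbar_ring_a_inv: "\<ominus>\<^bsub>qbar_ring\<^esub> x = - x"
proof -
  interpret field qbar_ring by (rule field_qbar_ring)
  show ?thesis
    by (rule minus_equality) (simp_all add: qbar_ring_simps)
qed

lemma qbar_ring_m_inv: "x \<noteq> 0 \<Longrightarrow> inv\<^bsub>qbar_ring\<^esub> x = inverse x"
proof -
  interpret field qbar_ring by (rule field_qbar_ring)
  assume "x \<noteq> 0"
  thus ?thesis
    by (intro comm_inv_char) (simp_all add: qbar_ring_simps)
qed

lemma generate_field_qbar_closed:
  assumes "x \<in> generate_field qbar_ring H" "y \<in> generate_field qbar_ring H"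
  shows "x + y \<in> generate_field qbar_ring H" "x * y \<in> generate_field qbar_ring H"
    "- x \<in> generate_field qbar_ring H" "x - y \<in> generate_field qbar_ring H"
    "inverse x \<in> generate_field qbar_ring H"
    "x / y \<in> generate_field qbar_ring H"
proof -
  let ?G = "generate_field qbar_ring H"
  have zero: "0 \<in> ?G"
    using field.zero_in_generate[OF field_qbar_ring] by (simp add: qbar_ring_simps)
  have add: "x + y \<in> ?G" and mult: "x * y \<in> ?G" if "x \<in> ?G" "y \<in> ?G" for x y
    using generate_field.eng_add[OF that] generate_field.eng_mult[OF that]
    by (simp_all add: qbar_ring_simps)
  have minus: "- x \<in> ?G" if "x \<in> ?G" for x
    using generate_field.a_inv[OF that] by (simp add: qbar_ring_a_inv)
  have inv: "inverse x \<in> ?G" if "x \<in> ?G" for x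
    using generate_field.m_inv[OF that] zero
    by (cases "x = 0") (simp_all add: qbar_ring_m_inv qbar_ring_simps)
  show "x + y \<in> ?G" "x * y \<in> ?G" "- x \<in> ?G" "inverse x \<in> ?G"
    using add[OF assms] mult[OF assms] minus[OF assms(1)] inv[OF assms(1)] by simp_all
  show "x - y \<in> ?G"
    using add[OF assms(1) minus[OF assms(2)]] by simp
  show "x / y \<in> ?G"
    using mult[OF assms(1) inv[OF assms(2)]] by (simp add: divide_inverse)
qed

lemma one_in_generate_field_qbar: "1 \<in> generate_field qbar_ring H"
  using generate_field.one[of qbar_ring H] by (simp add: qbar_ring_simps)

lemma of_int_in_generate_field_qbar: "of_int n \<in> generate_field qbar_ring H"
proof -
  have nat: "of_nat k \<in> generate_field qbar_ring H" for k
    by (induction k)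
      (use field.zero_in_generate[OF field_qbar_ring] in
        \<open>auto intro: generate_field_qbar_closed one_in_generate_field_qbar simp: qbar_ring_simps\<close>)
  show ?thesis
    by (cases n) (auto intro!: generate_field_qbar_closed(3) nat simp del: of_nat_Suc)
qed

lemma to_ac_in_generate_field_qbar: "to_ac (q :: rat) \<in> generate_field qbar_ring H"
proof -
  obtain a b where "q = of_int a / of_int b"
    by (cases q) (auto simp: Fract_of_int_quotient)
  thus ?thesis
    by (auto intro!: generate_field_qbar_closed of_int_in_generate_field_qbar)
qed

text \<open>Reduces an addition of points to two polynomial relations for the slope, so that the
  slope can be simplified before it is squared.\<close>

lemma ec_add_AffineI:
  assumes "\<not> (x1 = x2 \<and> y1 = - y2)"
    "s = (if x1 = x2 then (3 * x1 ^ 2 + A) / (2 * y1) else (y2 - y1) / (x2 - x1))"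
    "s ^ 2 = x3 + x1 + x2" "s * (x1 - x3) = y3 + y1"
  shows "ec_add A (Affine x1 y1) (Affine x2 y2) = Affine x3 y3"
proof -
  have "(x1 = x2 \<and> y1 = - y2) = False" "s ^ 2 - x1 - x2 = x3" "s * (x1 - x3) - y1 = y3"
    using assms(1,3,4) by simp_all
  thus ?thesis
    by (simp only: ec_add.simps Let_def assms(2) [symmetric] if_False)
qed

section \<open>The Gaussian field and the division fields\<close>

context
  fixes I :: qbar
  assumes I: "I ^ 2 = - 1"
begin

lemma sqrt_minus_one_mult_self: "I * I = - 1"
  using I by (simp add: power2_eq_square)

text \<open>Squaring the difference of two representations gives
  \<open>(u - u')\<^sup>2 + (v' - v)\<^sup>2 = 0\<close> over the rationals, which has only the
  trivial solution.\<close>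

lemma gauss_rat_eq_iff:
  "to_ac u + to_ac v * I = to_ac u' + to_ac v' * I \<longleftrightarrow> u = u' \<and> v = (v' :: rat)"
proof (intro iffI conjI)
  assume eq: "to_ac u + to_ac v * I = to_ac u' + to_ac v' * I"
  have "to_ac u - to_ac u' = to_ac (v' - v) * I"
    using eq by (simp add: algebra_simps)
  hence "to_ac ((u - u')\<^sup>2) = (to_ac (v' - v) * I) ^ 2"
    by simp
  also have "\<dots> = to_ac (- ((v' - v)\<^sup>2))"
    by (simp add: power_mult_distrib I)
  finally have "(u - u')\<^sup>2 + (v' - v)\<^sup>2 = 0"
    unfolding to_ac_inject by simp
  thus "u = u'" "v = v'" by (simp_all add: sum_power2_eq_zero_iff)
qed simp

definition gauss_rat :: "qbar set" where
  "gauss_rat = {to_ac u + to_ac v * I | u v. True}"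

lemma gauss_ratI: "x = to_ac u + to_ac v * I \<Longrightarrow> x \<in> gauss_rat"
  by (auto simp: gauss_rat_def)

lemma sqrt_minus_one_notin_rationals: "I \<notin> rationals"
  using gauss_rat_eq_iff[of 0 1 _ 0] by (auto simp: rationals_def)

lemma subfield_gauss_rat: "subfield gauss_rat qbar_ring"
proof -
  interpret field qbar_ring by (rule field_qbar_ring)
  show ?thesis
  proof (rule subfieldI', rule subringI)
    show "gauss_rat \<subseteq> carrier qbar_ring" by (simp add: qbar_ring_simps)
    show "\<one>\<^bsub>qbar_ring\<^esub> \<in> gauss_rat"
      by (rule gauss_ratI[of _ 1 0]) (simp add: qbar_ring_simps)
  next
    fix x assume "x \<in> gauss_rat"
    then obtain u v where x: "x = to_ac u + to_ac v * I" by (auto simp: gauss_rat_def)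
    show "\<ominus>\<^bsub>qbar_ring\<^esub> x \<in> gauss_rat"
      by (rule gauss_ratI[of _ "-u" "-v"]) (simp add: qbar_ring_a_inv x)
  next
    fix x y assume "x \<in> gauss_rat" "y \<in> gauss_rat"
    then obtain u v u' v' where x: "x = to_ac u + to_ac v * I" and y: "y = to_ac u' + to_ac v' * I"
      by (auto simp: gauss_rat_def)
    show "x \<oplus>\<^bsub>qbar_ring\<^esub> y \<in> gauss_rat"
      by (rule gauss_ratI[of _ "u + u'" "v + v'"]) (simp add: qbar_ring_simps x y algebra_simps)
    have "x * y = to_ac u * to_ac u' + to_ac v * to_ac v' * (I * I) + (to_ac u * to_ac v' + to_ac v * to_ac u') * I"
      by (simp add: x y algebra_simps)
    thus "x \<otimes>\<^bsub>qbar_ring\<^esub> y \<in> gauss_rat"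
      by (intro gauss_ratI[of _ "u * u' - v * v'" "u * v' + v * u'"])
        (simp add: qbar_ring_simps sqrt_minus_one_mult_self)
  next
    fix x assume "x \<in> gauss_rat - {\<zero>\<^bsub>qbar_ring\<^esub>}"
    then obtain u v where x: "x = to_ac u + to_ac v * I" and nz: "x \<noteq> 0"
      by (auto simp: gauss_rat_def qbar_ring_simps)
    define n where "n = u\<^sup>2 + v\<^sup>2"
    have "n \<noteq> 0" using nz by (auto simp: n_def x sum_power2_eq_zero_iff)
    hence n: "to_ac n \<noteq> 0" using to_ac_inject[of n 0] by simp
    have "x * (to_ac u - to_ac v * I) = to_ac u ^ 2 - to_ac v ^ 2 * (I * I)"
      by (simp add: x algebra_simps power2_eq_square)
    also have "\<dots> = to_ac n"
      by (simp add: sqrt_minus_one_mult_self n_def)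
    finally have "inverse x = (to_ac u - to_ac v * I) / to_ac n"
      using nz n by (simp add: field_simps)
    thus "inv\<^bsub>qbar_ring\<^esub> x \<in> gauss_rat"
      using nz by (intro gauss_ratI[of _ "u / n" "- v / n"]) (simp add: qbar_ring_m_inv field_simps n)
  qed
qed

text \<open>An automorphism is determined by the image of \<open>I\<close>, which is
  \<open>I\<close> or \<open>- I\<close>. The map \<open>h\<close> records this sign additively, and
  conjugation \<open>c\<close> shows that both signs occur.\<close>

lemma galois_group_gauss_rat: "galois_group gauss_rat rationals \<cong> integer_mod_group 2"
proof -
  let ?G = "galois_group gauss_rat rationals"
  let ?K = "gauss_rat"
  have rat_sub: "to_ac u \<in> ?K" for u by (rule gauss_ratI[of _ u 0]) simp
  have I_in: "I \<in> ?K" by (rule gauss_ratI[of _ 0 1]) simp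
  have add_in: "x + y \<in> ?K" "x * y \<in> ?K" if "x \<in> ?K" "y \<in> ?K" for x y
    using subringE(6,7)[OF subfieldE(1)[OF subfield_gauss_rat] that] by (simp_all add: qbar_ring_simps)
  have car: "\<sigma> \<in> carrier ?G \<longleftrightarrow> \<sigma> \<in> Bij ?K \<and> (\<forall>x\<in>?K. \<forall>y\<in>?K. \<sigma> (x + y) = \<sigma> x + \<sigma> y \<and> \<sigma> (x * y) = \<sigma> x * \<sigma> y)
      \<and> \<sigma> 1 = 1 \<and> (\<forall>u. \<sigma> (to_ac u) = to_ac u)" for \<sigma>
    using Bij_imp_funcset[of \<sigma> ?K]
    by (auto simp: galois_group_def ring_hom_def qbar_ring_simps rationals_def)
  have formula: "\<sigma> (to_ac u + to_ac v * I) = to_ac u + to_ac v * \<sigma> I" if "\<sigma> \<in> carrier ?G" for \<sigma> u v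
    using that rat_sub I_in add_in by (auto simp: car)
  have img: "\<sigma> I = I \<or> \<sigma> I = - I" if "\<sigma> \<in> carrier ?G" for \<sigma>
  proof -
    have "\<sigma> I * \<sigma> I = \<sigma> (I * I)" using that I_in by (auto simp: car)
    also have "\<dots> = \<sigma> (to_ac (-1))" by (simp add: sqrt_minus_one_mult_self)
    also have "\<dots> = to_ac (-1)" using that unfolding car by blast
    finally have "(\<sigma> I - I) * (\<sigma> I + I) = 0"
      using sqrt_minus_one_mult_self by (simp add: algebra_simps)
    thus ?thesis by (auto simp: eq_neg_iff_add_eq_0)
  qed
  have I_neq: "I \<noteq> - I" using gauss_rat_eq_iff[of 0 1 0 "-1"] by simp
  define h where "h = (\<lambda>\<sigma> :: qbar \<Rightarrow> qbar. if \<sigma> I = I then 0 else 1 :: int)"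
  \<comment> \<open>The value \<open>undefined\<close> off the field is forced: elements of
    \<open>Bij\<close> are extensional. The description picks the coordinates, which are unique by
    \<open>gauss_rat_eq_iff\<close>.\<close>
  define c where "c = (\<lambda>x. if x \<in> ?K then (case (THE p. x = to_ac (fst p) + to_ac (snd p) * I) of (u, v) \<Rightarrow> to_ac u - to_ac v * I) else undefined)"
  have c: "c (to_ac u + to_ac v * I) = to_ac u - to_ac v * I" for u v
  proof -
    have "(THE p. to_ac u + to_ac v * I = to_ac (fst p) + to_ac (snd p) * I) = (u, v)"
      by (rule the_equality) (auto simp: gauss_rat_eq_iff)
    thus ?thesis by (auto simp: c_def gauss_ratI)
  qed
  have c_cc: "c (c x) = x" "c x \<in> ?K" if "x \<in> ?K" for x
  proof -
    obtain u v where x: "x = to_ac u + to_ac v * I" using \<open>x \<in> ?K\<close> by (auto simp: gauss_rat_def)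
    have "c x = to_ac u + to_ac (- v) * I" by (simp add: x c)
    thus "c (c x) = x" "c x \<in> ?K" by (simp_all only: c gauss_ratI) (simp add: x)
  qed
  have c_in: "c \<in> carrier ?G"
    unfolding car
  proof (intro conjI ballI allI)
    have "bij_betw c ?K ?K"
      by (rule bij_betwI[of _ _ _ c]) (auto simp: c_cc)
    moreover have "c \<in> extensional ?K" by (auto simp: c_def extensional_def)
    ultimately show "c \<in> Bij ?K" by (simp add: Bij_def)
    show "c (to_ac u) = to_ac u" for u using c[of u 0] by simp
    show "c 1 = 1" using c[of 1 0] by simp
    fix x y assume "x \<in> ?K" "y \<in> ?K"
    then obtain u v u' v' where x: "x = to_ac u + to_ac v * I" and y: "y = to_ac u' + to_ac v' * I"
      by (auto simp: gauss_rat_def)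
    have "x + y = to_ac (u + u') + to_ac (v + v') * I" by (simp add: x y algebra_simps)
    thus "c (x + y) = c x + c y" by (simp only: c x y) (simp add: algebra_simps)
    have "x * y = to_ac u * to_ac u' + to_ac v * to_ac v' * (I * I) + (to_ac u * to_ac v' + to_ac v * to_ac u') * I"
      by (simp add: x y algebra_simps)
    also have "\<dots> = to_ac (u * u' - v * v') + to_ac (u * v' + v * u') * I"
      by (simp add: sqrt_minus_one_mult_self)
    finally have "c (x * y) = to_ac (u * u' - v * v') - to_ac (u * v' + v * u') * I"
      by (simp only: c)
    also have "\<dots> = to_ac u * to_ac u' + to_ac v * to_ac v' * (I * I) - (to_ac u * to_ac v' + to_ac v * to_ac u') * I"
      by (simp add: sqrt_minus_one_mult_self)
    also have "\<dots> = c x * c y" unfolding x y c by (simp add: algebra_simps)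
    finally show "c (x * y) = c x * c y" .
  qed
  have id_in: "(\<lambda>x\<in>?K. x) \<in> carrier ?G"
    unfolding car using id_Bij[of ?K] add_in rat_sub rat_sub[of 1] by auto
  have "h \<in> hom ?G (integer_mod_group 2)"
  proof (rule homI)
    fix \<sigma> \<tau> assume st: "\<sigma> \<in> carrier ?G" "\<tau> \<in> carrier ?G"
    have "(\<sigma> \<otimes>\<^bsub>?G\<^esub> \<tau>) I = \<sigma> (\<tau> I)"
      using st I_in by (auto simp: car galois_group_def BijGroup_def compose_def)
    moreover have "\<sigma> (- I) = - \<sigma> I"
      using formula[OF st(1), of 0 "-1"] by simp
    ultimately show "h (\<sigma> \<otimes>\<^bsub>?G\<^esub> \<tau>) = h \<sigma> \<otimes>\<^bsub>integer_mod_group 2\<^esub> h \<tau>"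
      using img[OF st(1)] img[OF st(2)] I_neq by (auto simp: h_def)
  qed (auto simp: h_def carrier_integer_mod_group)
  moreover have "bij_betw h (carrier ?G) (carrier (integer_mod_group 2))"
  proof (rule bij_betw_imageI)
    show "inj_on h (carrier ?G)"
    proof (rule inj_onI)
      fix \<sigma> \<tau> assume st: "\<sigma> \<in> carrier ?G" "\<tau> \<in> carrier ?G" "h \<sigma> = h \<tau>"
      have eq: "\<sigma> I = \<tau> I" using img[OF st(1)] img[OF st(2)] st(3) by (auto simp: h_def split: if_splits)
      show "\<sigma> = \<tau>"
      proof (rule extensionalityI[of _ ?K])
        show "\<sigma> \<in> extensional ?K" "\<tau> \<in> extensional ?K"
          using st by (auto simp: car Bij_def)
        show "\<sigma> x = \<tau> x" if "x \<in> ?K" for x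
          using that eq by (auto simp: gauss_rat_def formula[OF st(1)] formula[OF st(2)])
      qed
    qed
    have "h c = 1" using c[of 0 1] I_neq by (auto simp: h_def)
    moreover have "h (\<lambda>x\<in>?K. x) = 0" using I_in by (simp add: h_def)
    ultimately have "{0, 1} \<subseteq> h ` carrier ?G"
      using c_in id_in by (metis empty_subsetI image_eqI insert_subset)
    moreover have "h ` carrier ?G \<subseteq> {0, 1}" by (auto simp: h_def)
    moreover have "carrier (integer_mod_group 2) = {0, 1}" by (auto simp: carrier_integer_mod_group)
    ultimately show "h ` carrier ?G = carrier (integer_mod_group 2)" by blast
  qed
  ultimately show ?thesis
    by (auto simp: is_iso_def iso_def)
qed

text \<open>A finite point of order 2 has \<open>y = 0\<close>, and \<open>x ^ 3 + d ^ 2 * x\<close>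
  splits as \<open>x * (x - d * I) * (x + d * I)\<close>.\<close>

lemma division_field_2_subset_gauss_rat:
  "division_field (d ^ 2, 0) 2 \<subseteq> gauss_rat"
proof -
  have "x \<in> gauss_rat \<and> y \<in> gauss_rat" if "Affine x y \<in> torsion (d ^ 2, 0) 2" for x y
  proof -
    let ?d = "to_ac d"
    have "y = - y" and eq: "y ^ 2 = x ^ 3 + ?d ^ 2 * x"
      using that by (auto simp: torsion_def ec_mult_def ec_points_def numeral_2_eq_2 Let_def split: if_splits)
    hence "2 * y = 0" by simp
    hence y: "y = 0" by simp
    have "x * ((x - ?d * I) * (x + ?d * I)) = x ^ 3 - ?d ^ 2 * x * (I * I)"
      by (simp add: algebra_simps power3_eq_cube power2_eq_square)
    also have "\<dots> = 0" using eq y by (simp add: sqrt_minus_one_mult_self)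
    finally have "x = 0 \<or> x = ?d * I \<or> x = - (?d * I)"
      by (auto simp: eq_neg_iff_add_eq_0)
    thus ?thesis
      using y gauss_ratI[of 0 0 0] gauss_ratI[of x 0 d] gauss_ratI[of x 0 "- d"] by auto
  qed
  thus ?thesis
    unfolding division_field_def
    by (intro field.generate_field_min_subfield1[OF field_qbar_ring] subfield_gauss_rat)
      (auto simp: qbar_ring_simps)
qed

lemma gauss_rat_subset_generate_field:
  assumes "I \<in> generate_field qbar_ring H"
  shows "gauss_rat \<subseteq> generate_field qbar_ring H"
  by (auto simp: gauss_rat_def intro!: generate_field_qbar_closed to_ac_in_generate_field_qbar assms)

lemma sqrt_minus_one_in_division_field_2:
  assumes "d \<noteq> 0"
  shows "I \<in> division_field (d ^ 2, 0) 2"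
proof -
  let ?d = "to_ac d"
  have d: "?d \<noteq> 0" using assms to_ac_inject[of d 0] by simp
  have "(?d * I) ^ 3 + ?d ^ 2 * (?d * I) = ?d ^ 3 * I * (I * I + 1)"
    by (simp add: algebra_simps power3_eq_cube power2_eq_square)
  hence "Affine (?d * I) 0 \<in> torsion (d ^ 2, 0) 2"
    by (auto simp: torsion_def ec_mult_def ec_points_def numeral_2_eq_2 sqrt_minus_one_mult_self)
  hence "?d * I \<in> division_field (d ^ 2, 0) 2"
    unfolding division_field_def by (intro generate_field.incl) auto
  hence "?d * I / ?d \<in> division_field (d ^ 2, 0) 2"
    unfolding division_field_def by (rule generate_field_qbar_closed(6)[OF _ to_ac_in_generate_field_qbar])
  thus ?thesis using d by simp
qed

text \<open>The point below is annihilated by the endomorphism \<open>2 - I\<close> of norm 5, and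
  its abscissa already determines \<open>I\<close> rationally.\<close>

lemma sqrt_minus_one_in_division_field_5:
  assumes "d \<noteq> 0"
  shows "I \<in> division_field (d ^ 2, 0) 5"
proof -
  let ?d = "to_ac d"
  have d: "?d \<noteq> 0" using assms to_ac_inject[of d 0] by simp
  \<comment> \<open>With \<open>A = d ^ 2\<close>, the abscissa of \<open>2 P\<close> is
    \<open>- x\<close> exactly if the tangent slope squared is \<open>x\<close>, that is
    \<open>(3 * x ^ 2 + A) ^ 2 = 4 * x * y ^ 2\<close>, or
    \<open>5 * x ^ 4 + 2 * A * x ^ 2 + A ^ 2 = 0\<close>. Its solutions are
    \<open>x ^ 2 = A * (- 1 \<plusminus> 2 * I) / 5\<close>; the sign chosen gives
    \<open>2 P\<close> the ordinate \<open>I * y\<close>.\<close>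
  obtain x :: qbar where x: "x ^ 2 = ?d ^ 2 * (2 * I - 1) / 5"
    using nth_root_exists[of 2 "?d ^ 2 * (2 * I - 1) / 5"] by auto
  obtain y :: qbar where y: "y ^ 2 = x ^ 3 + ?d ^ 2 * x"
    using nth_root_exists[of 2 "x ^ 3 + ?d ^ 2 * x"] by auto
  have II: "I * I = - 1" by (rule sqrt_minus_one_mult_self)
  have "(2 * I - 1) * (2 * I + 1) = 4 * (I * I) - 1" by (simp add: algebra_simps)
  hence "2 * I - 1 \<noteq> 0" by (auto simp: II)
  hence x0: "x \<noteq> 0" using x d by auto
  have x5: "5 * x ^ 2 = ?d ^ 2 * (2 * I - 1)" unfolding x by simp
  \<comment> \<open>The aim is to eliminate \<open>d\<close>: the curve equation becomes
    \<open>y ^ 2 = - 2 * I * x ^ 3\<close>, and the slopes below depend on \<open>x\<close>,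
    \<open>y\<close> and \<open>I\<close> only.\<close>
  have "5 * (x ^ 2 + ?d ^ 2 + 2 * I * x ^ 2) = (5 * x ^ 2) * (1 + 2 * I) + 5 * ?d ^ 2"
    by (simp add: algebra_simps)
  also have "\<dots> = 4 * ?d ^ 2 * (1 + I * I)" unfolding x5 by (simp add: algebra_simps)
  also have "\<dots> = 0" by (simp add: II)
  finally have xd: "x ^ 2 + ?d ^ 2 = - (2 * I * x ^ 2)"
    by (metis mult_eq_0_iff qbar_numeral_neq_0 eq_neg_iff_add_eq_0)
  have "y ^ 2 = x * (x ^ 2 + ?d ^ 2)"
    unfolding y by (simp add: algebra_simps power2_eq_square power3_eq_cube)
  hence yy: "y ^ 2 = - (2 * I * x ^ 3)"
    unfolding xd by (simp add: power2_eq_square power3_eq_cube)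
  have "I \<noteq> 0" using II by auto
  hence y0: "y \<noteq> 0" using yy x0 by auto
  let ?A = "?d ^ 2" and ?P = "Affine x y"
  have yI: "I * y ^ 2 = 2 * x ^ 3"
  proof -
    have "I * y ^ 2 = - (2 * (I * I) * x ^ 3)" by (simp add: yy)
    thus ?thesis by (simp add: II)
  qed
  have P2: "ec_add ?A ?P ?P = Affine (- x) (I * y)"
  proof -
    define s where "s = (3 * x ^ 2 + ?A) / (2 * y)"
    have "3 * x ^ 2 + ?A = 2 * x ^ 2 + (x ^ 2 + ?A)" by simp
    also have "\<dots> = 2 * (x ^ 2 * (1 - I))" unfolding xd by (simp add: algebra_simps)
    finally have s: "s = x ^ 2 * (1 - I) / y"
      using y0 by (simp add: s_def)
    have "s ^ 2 * y ^ 2 = x ^ 4 * (1 - 2 * I + I * I)"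
      using y0 by (simp add: s power_divide power_mult_distrib) (simp add: power2_eq_square algebra_simps)
    also have "\<dots> = x * y ^ 2"
      unfolding yy by (simp add: II eval_nat_numeral)
    finally have s2: "s ^ 2 = x" using y0 by simp
    have "s * (2 * x) * y = 2 * x ^ 3 * (1 - I)"
      using y0 by (simp add: s power2_eq_square power3_eq_cube)
    also have "\<dots> = 2 * x ^ 3 + y * y"
      using yy by (simp add: power2_eq_square algebra_simps)
    also have "\<dots> = (I * y + y) * y"
      by (simp flip: yI add: power2_eq_square algebra_simps)
    finally have "s * (2 * x) = I * y + y" using y0 by simp
    thus ?thesis
      using y0 s2 by (intro ec_add_AffineI[of _ _ _ _ s]) (simp_all add: s_def eq_neg_iff_add_eq_0)
  qed
  \<comment> \<open>From \<open>5 P = 0\<close> one expects \<open>3 P = - 2 P\<close> and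
    \<open>4 P = - P\<close>, which predicts the coordinates here and in the next step.\<close>
  have P3: "ec_add ?A ?P (Affine (- x) (I * y)) = Affine (- x) (- (I * y))"
  proof -
    define s where "s = (I * y - y) / (- x - x)"
    have sx: "s * (2 * x) = y - I * y"
      using x0 by (simp add: s_def field_simps)
    have "s ^ 2 * (2 * x) ^ 2 = y ^ 2 * (1 - 2 * I + I * I)"
      unfolding power_mult_distrib [symmetric] sx by (simp add: power2_eq_square algebra_simps)
    also have "\<dots> = - (I * y ^ 2) * 2" by (simp add: II)
    also have "\<dots> = - x * (2 * x) ^ 2"
      unfolding yI by (simp add: power2_eq_square power3_eq_cube)
    finally have "s ^ 2 = - x" by (rule mult_right_cancel [THEN iffD1, rotated]) (simp add: x0)
    thus ?thesis
      using x0 sx by (intro ec_add_AffineI[of _ _ _ _ s]) (simp_all add: s_def eq_neg_iff_add_eq_0)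
  qed
  have P4: "ec_add ?A ?P (Affine (- x) (- (I * y))) = Affine x (- y)"
  proof -
    define s where "s = (- (I * y) - y) / (- x - x)"
    have sx: "s * (2 * x) = y + I * y"
      using x0 by (simp add: s_def field_simps)
    have "s ^ 2 * (2 * x) ^ 2 = y ^ 2 * (1 + 2 * I + I * I)"
      unfolding power_mult_distrib [symmetric] sx by (simp add: power2_eq_square algebra_simps)
    also have "\<dots> = I * y ^ 2 * 2" by (simp add: II)
    also have "\<dots> = x * (2 * x) ^ 2"
      unfolding yI by (simp add: power2_eq_square power3_eq_cube)
    finally have "s ^ 2 = x" by (rule mult_right_cancel [THEN iffD1, rotated]) (simp add: x0)
    thus ?thesis
      using x0 by (intro ec_add_AffineI[of _ _ _ _ s]) (simp_all add: s_def eq_neg_iff_add_eq_0)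
  qed
  have "ec_mult (d ^ 2, 0) 5 ?P = ec_add ?A ?P (ec_add ?A ?P (ec_add ?A ?P (ec_add ?A ?P (ec_add ?A ?P Infinity))))"
    by (simp add: ec_mult_def eval_nat_numeral)
  also have "\<dots> = Infinity"
    unfolding ec_add.simps(2) P2 P3 P4 by simp
  finally have "?P \<in> torsion (d ^ 2, 0) 5"
    using y by (auto simp: torsion_def ec_points_def)
  hence xin: "x \<in> division_field (d ^ 2, 0) 5"
    unfolding division_field_def by (intro generate_field.incl) auto
  have "I = (5 * (x * x) / ?d ^ 2 + 1) / 2"
    using x d by (simp add: power2_eq_square field_simps)
  also have "\<dots> = (to_ac 5 * (x * x) / to_ac (d ^ 2) + 1) / to_ac 2" by simp
  also have "\<dots> \<in> division_field (d ^ 2, 0) 5"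
    using xin unfolding division_field_def
    by (intro generate_field_qbar_closed to_ac_in_generate_field_qbar one_in_generate_field_qbar)
  finally show ?thesis .
qed

lemma division_fields_inter:
  assumes "d \<noteq> 0"
  shows "division_field (d ^ 2, 0) 2 \<inter> division_field (d ^ 2, 0) 5 = gauss_rat"
  using division_field_2_subset_gauss_rat[of d] sqrt_minus_one_in_division_field_2[OF assms]
    sqrt_minus_one_in_division_field_5[OF assms] gauss_rat_subset_generate_field
  unfolding division_field_def by blast

end

lemma has_25_entanglement_twist:
  assumes "d \<noteq> 0"
  shows "has_25_entanglement_Z2 (d ^ 2, 0)"
proof -
  obtain I :: qbar where I: "I ^ 2 = - 1"
    using nth_root_exists[of 2 "- 1 :: qbar"] by auto
  have "I \<in> gauss_rat I" using gauss_ratI[OF I, of I 0 1] by simp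
  thus ?thesis
    using sqrt_minus_one_notin_rationals[OF I] galois_group_gauss_rat[OF I]
    unfolding has_25_entanglement_Z2_def Let_def division_fields_inter[OF I assms] by auto
qed

section \<open>Isomorphism classes and minimal models\<close>

lemma equiv_ec_iso: "equiv elliptic_curves ec_iso"
proof (rule equivI)
  show "refl_on elliptic_curves ec_iso"
    by (rule refl_onI) (auto simp: ec_iso_def intro: exI[of _ 1])
  show "sym ec_iso"
  proof (rule symI)
    fix E E' assume "(E, E') \<in> ec_iso"
    then show "(E', E) \<in> ec_iso"
      by (auto simp: ec_iso_def field_simps intro: exI[of _ "inverse u" for u])
  qed
  show "trans ec_iso"
  proof (rule transI)
    fix E E' E'' assume "(E, E') \<in> ec_iso" "(E', E'') \<in> ec_iso"
    then obtain u v where uv: "u \<noteq> 0" "v \<noteq> 0" "fst E' = u ^ 4 * fst E" "snd E' = u ^ 6 * snd E"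
      "fst E'' = v ^ 4 * fst E'" "snd E'' = v ^ 6 * snd E'"
      and E: "E \<in> elliptic_curves" "E'' \<in> elliptic_curves"
      by (auto simp: ec_iso_def)
    have "fst E'' = (v * u) ^ 4 * fst E" "snd E'' = (v * u) ^ 6 * snd E"
      by (simp_all add: uv power_mult_distrib)
    thus "(E, E'') \<in> ec_iso"
      using E uv(1,2) unfolding ec_iso_def by (cases E; cases E'') (auto intro!: exI[of _ "v * u"])
  qed
  show "ec_iso \<subseteq> elliptic_curves \<times> elliptic_curves"
    by (auto simp: ec_iso_def)
qed

text \<open>In lowest terms \<open>u = p / q\<close>, the numerator gives powers dividing
  \<open>(A', B')\<close> and the denominator powers dividing \<open>(A, B)\<close>. Minimality of
  both leaves \<open>u = 1\<close> or \<open>u = - 1\<close>, and only even powers of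
  \<open>u\<close> occur.\<close>

lemma minimal_pair_eq_if_iso:
  fixes u :: rat
  assumes "minimal_pair A B" "minimal_pair A' B'" and u: "u \<noteq> 0"
    "of_int A' = u ^ 4 * of_int A" "of_int B' = u ^ 6 * of_int B"
  shows "A' = A \<and> B' = B"
proof -
  obtain p q where pq: "u = of_int p / of_int q" "q > 0" "coprime p q"
    by (cases u) (auto simp: Fract_of_int_quotient)
  have p0: "p \<noteq> 0" using u pq by auto
  have "of_int (q ^ 4 * A') = (of_int (p ^ 4 * A) :: rat)"
    using u(2) pq by (simp add: field_simps)
  hence A: "q ^ 4 * A' = p ^ 4 * A" by linarith
  have "of_int (q ^ 6 * B') = (of_int (p ^ 6 * B) :: rat)"
    using u(3) pq by (simp add: field_simps)
  hence B: "q ^ 6 * B' = p ^ 6 * B" by linarith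
  have "p ^ 4 dvd A'" "p ^ 6 dvd B'"
    using A B pq(3) by (metis coprime_dvd_mult_right_iff coprime_power_left_iff coprime_power_right_iff dvd_triv_left)+
  hence "\<bar>p\<bar> ^ 4 dvd A' \<and> \<bar>p\<bar> ^ 6 dvd B'" by (simp add: power_even_abs)
  hence p: "\<bar>p\<bar> = 1"
    using assms(2) p0 unfolding minimal_pair_def by (metis abs_of_pos linorder_neqE_linordered_idom zabs_less_one_iff zero_less_abs_iff)
  have "q ^ 4 dvd A" "q ^ 6 dvd B"
    using A B pq(3) by (metis coprime_commute coprime_dvd_mult_right_iff coprime_power_left_iff coprime_power_right_iff dvd_triv_left)+
  hence q: "q = 1"
    using assms(1) pq(2) unfolding minimal_pair_def by (metis int_one_le_iff_zero_less order_le_less)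
  have "p = 1 \<or> p = - 1" using p by linarith
  thus ?thesis using A B q by auto
qed

lemma minimal_model_eqI:
  assumes "minimal_pair A B" "(E, (of_int A, of_int B)) \<in> ec_iso"
  shows "minimal_model E = (A, B)"
  unfolding minimal_model_def
proof (rule the_equality)
  show "case (A, B) of (A, B) \<Rightarrow> minimal_pair A B \<and> (E, (of_int A, of_int B)) \<in> ec_iso"
    using assms by simp
next
  fix P assume "case P of (A, B) \<Rightarrow> minimal_pair A B \<and> (E, (of_int A, of_int B)) \<in> ec_iso"
  then obtain A' B' where P: "P = (A', B')" "minimal_pair A' B'" "(E, (of_int A', of_int B')) \<in> ec_iso"
    by (cases P) auto
  hence "((of_int A, of_int B), (of_int A', of_int B')) \<in> ec_iso"
    using assms(2) equiv_ec_iso by (meson equivE symE transE)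
  thus "P = (A, B)"
    using minimal_pair_eq_if_iso[OF assms(1) P(2)] P(1) by (auto simp: ec_iso_def)
qed

text \<open>Clearing denominators with \<open>u = q * s\<close> gives an integral model. Among all
  integral models, one with the least absolute discriminant is minimal, as removing
  \<open>m ^ 4\<close> and \<open>m ^ 6\<close> divides the discriminant by
  \<open>m ^ 12\<close>.\<close>

lemma minimal_model_exists:
  assumes "E \<in> elliptic_curves"
  shows "\<exists>A B. minimal_pair A B \<and> (E, (of_int A, of_int B)) \<in> ec_iso"
proof -
  define S where "S = {(A, B). (E, (of_int A, of_int B)) \<in> ec_iso}"
  define D where "D = (\<lambda>(A, B). nat \<bar>4 * A ^ 3 + 27 * B ^ 2 :: int\<bar>)"
  obtain a b where E: "E = (a, b)" by (cases E)
  obtain p q where a: "a = of_int p / of_int q" "q > 0"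
    by (cases a) (auto simp: Fract_of_int_quotient)
  obtain r s where b: "b = of_int r / of_int s" "s > 0"
    by (cases b) (auto simp: Fract_of_int_quotient)
  let ?u = "of_int (q * s) :: rat"
  have u: "?u \<noteq> 0" using a b by simp
  have scale: "(u ^ 4 * A, u ^ 6 * B) \<in> elliptic_curves \<longleftrightarrow> (A, B) \<in> elliptic_curves" if "u \<noteq> 0" for u A B
  proof -
    have "4 * (u ^ 4 * A) ^ 3 + 27 * (u ^ 6 * B) ^ 2 = u ^ 12 * (4 * A ^ 3 + 27 * B ^ 2)"
      by (simp add: power_mult_distrib algebra_simps flip: power_mult)
    thus ?thesis using that by (simp add: elliptic_curves_def)
  qed
  have "of_int (p * q ^ 3 * s ^ 4) = ?u ^ 4 * a" "of_int (r * s ^ 5 * q ^ 6) = ?u ^ 6 * b"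
    using a b by (simp_all add: field_simps eval_nat_numeral)
  hence "(E, (of_int (p * q ^ 3 * s ^ 4), of_int (r * s ^ 5 * q ^ 6))) \<in> ec_iso"
    using assms u unfolding ec_iso_def E
    by (auto simp del: of_int_mult of_int_power simp: scale intro!: exI[of _ ?u])
  hence "(p * q ^ 3 * s ^ 4, r * s ^ 5 * q ^ 6) \<in> S" by (simp add: S_def)
  then obtain P where P: "P \<in> S" and least: "\<And>Q. Q \<in> S \<Longrightarrow> D P \<le> D Q"
    using ex_has_least_nat[of "\<lambda>P. P \<in> S" _ D] by blast
  obtain A B where AB: "P = (A, B)" by (cases P)
  have iso: "(E, (of_int A, of_int B)) \<in> ec_iso" using P by (simp add: S_def AB)
  have "minimal_pair A B"
    unfolding minimal_pair_def
  proof
    assume "\<exists>m>1. m ^ 4 dvd A \<and> m ^ 6 dvd B"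
    then obtain m A' B' where m: "m > 1" "A = m ^ 4 * A'" "B = m ^ 6 * B'"
      by (auto elim!: dvdE)
    have E': "(of_int A :: rat, of_int B) \<in> elliptic_curves" using iso by (auto simp: ec_iso_def)
    have "(of_int A', of_int B') \<in> elliptic_curves"
      using E' scale[of "of_int m" "of_int A'" "of_int B'"] m by simp
    hence "((of_int A', of_int B'), (of_int A, of_int B)) \<in> ec_iso"
      using E' m unfolding ec_iso_def by (auto intro!: exI[of _ "of_int m"])
    hence "(E, (of_int A', of_int B')) \<in> ec_iso"
      using iso equiv_ec_iso by (meson equivE symE transE)
    hence le: "D (A, B) \<le> D (A', B')" using least[of "(A', B')"] by (simp add: S_def AB)
    define d where "d = 4 * A' ^ 3 + 27 * B' ^ 2"
    have "of_int d \<noteq> (0 :: rat)"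
      using \<open>(of_int A', of_int B') \<in> elliptic_curves\<close> by (simp add: elliptic_curves_def d_def)
    hence d0: "\<bar>d\<bar> > 0" by simp
    have "4 * A ^ 3 + 27 * B ^ 2 = m ^ 12 * d"
      by (simp add: m d_def power_mult_distrib algebra_simps flip: power_mult)
    hence "\<bar>m ^ 12\<bar> * \<bar>d\<bar> \<le> 1 * \<bar>d\<bar>"
      using le by (simp add: D_def d_def [symmetric] abs_mult)
    hence "m ^ 12 \<le> 1" using d0 m by simp
    moreover have "m ^ 12 > 1" using m by (intro one_less_power) auto
    ultimately show False by simp
  qed
  thus ?thesis using iso by blast
qed

lemma finite_model_height_le: "finite {(A, B). of_int (model_height A B) \<le> (x :: real)}"
proof (rule finite_subset)
  show "{(A, B). of_int (model_height A B) \<le> x} \<subseteq> {- \<lfloor>x\<rfloor>..\<lfloor>x\<rfloor>} \<times> {- \<lfloor>x\<rfloor>..\<lfloor>x\<rfloor>}"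
  proof safe
    fix A B assume "of_int (model_height A B) \<le> x"
    hence "model_height A B \<le> \<lfloor>x\<rfloor>" by (simp add: le_floor_iff)
    hence h: "4 * \<bar>A\<bar> ^ 3 \<le> \<lfloor>x\<rfloor>" "27 * \<bar>B\<bar> ^ 2 \<le> \<lfloor>x\<rfloor>"
      unfolding model_height_def by linarith+
    have "\<bar>A\<bar> \<le> \<bar>A\<bar> ^ 3" "\<bar>B\<bar> \<le> \<bar>B\<bar> ^ 2"
      using self_le_power[of "\<bar>A\<bar>" 3] self_le_power[of "\<bar>B\<bar>" 2]
      by (cases "A = 0"; cases "B = 0"; simp; linarith)+
    hence "\<bar>A\<bar> \<le> \<lfloor>x\<rfloor>" "\<bar>B\<bar> \<le> \<lfloor>x\<rfloor>" using h by linarith+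
    thus "A \<in> {- \<lfloor>x\<rfloor>..\<lfloor>x\<rfloor>}" "B \<in> {- \<lfloor>x\<rfloor>..\<lfloor>x\<rfloor>}" by auto
  qed
qed simp

text \<open>Since \<open>card\<close> is 0 on infinite sets, a lower bound for the number of classes
  requires finiteness. Each class contains its minimal model, and the height bounds the coefficients
  of that model.\<close>

lemma finite_classes_bounded_height:
  "finite ({E \<in> elliptic_curves. of_int (naive_height E) \<le> (x :: real) \<and> P E} // ec_iso)"
proof (rule finite_subset)
  let ?f = "\<lambda>(A, B). ec_iso `` {(of_int A, of_int B)}"
  show "{E \<in> elliptic_curves. of_int (naive_height E) \<le> x \<and> P E} // ec_iso
    \<subseteq> ?f ` {(A, B). of_int (model_height A B) \<le> x}"
  proof
    fix c assume "c \<in> {E \<in> elliptic_curves. of_int (naive_height E) \<le> x \<and> P E} // ec_iso"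
    then obtain E where E: "E \<in> elliptic_curves" "of_int (naive_height E) \<le> x" "c = ec_iso `` {E}"
      by (auto simp: quotient_def)
    obtain A B where AB: "minimal_pair A B" "(E, (of_int A, of_int B)) \<in> ec_iso"
      using minimal_model_exists[OF E(1)] by blast
    have "c = ?f (A, B)"
      using E(3) equiv_class_eq[OF equiv_ec_iso AB(2)] by simp
    moreover have "of_int (model_height A B) \<le> x"
      using E(2) by (simp add: naive_height_def minimal_model_eqI[OF AB])
    ultimately show "c \<in> ?f ` {(A, B). of_int (model_height A B) \<le> x}"
      by blast
  qed
  show "finite (?f ` {(A, B). of_int (model_height A B) \<le> x})"
    by (intro finite_imageI finite_model_height_le)
qed

section \<open>Counting the squarefree twists\<close>

lemma card_squarefree_ge:
  fixes n :: nat
  shows "sqrt n \<le> real (card {d \<in> {1..n}. squarefree d})"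
proof -
  let ?S = "{d \<in> {1..n}. squarefree d}"
  define r where "r = nat \<lfloor>sqrt n\<rfloor>"
  \<comment> \<open>Each \<open>m \<le> n\<close> is a squarefree number times a square
    \<open>k ^ 2\<close> with \<open>k \<le> sqrt n\<close>, so the squarefree numbers are at least
    \<open>n / sqrt n\<close> in number.\<close>
  have sub: "{1..n} \<subseteq> (\<lambda>(d, k). d * k ^ 2) ` (?S \<times> {1..r})"
  proof
    fix m assume m: "m \<in> {1..n}"
    let ?d = "squarefree_part m" and ?k = "square_part m"
    have dec: "m = ?d * ?k ^ 2" by (rule squarefree_decompose)
    have k0: "?k > 0"
      using m by (metis atLeastAtMost_iff gr0I not_one_le_zero square_part_0_iff)
    have d0: "?d > 0" by (metis gr0I squarefree_part_nonzero)
    have "?d * 1 \<le> ?d * ?k ^ 2" "1 * ?k ^ 2 \<le> ?d * ?k ^ 2"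
      using k0 d0 by (intro mult_le_mono; simp)+
    hence le: "?d \<le> n" "?k ^ 2 \<le> n"
      using m dec by auto
    have "real ?k \<le> sqrt n"
      using le(2) by (intro real_le_rsqrt) (simp flip: of_nat_power)
    hence "?k \<le> r" by (simp add: r_def le_nat_floor)
    thus "m \<in> (\<lambda>(d, k). d * k ^ 2) ` (?S \<times> {1..r})"
      using dec le k0 d0 by (intro image_eqI[of _ _ "(?d, ?k)"]) (auto simp: squarefree_squarefree_part)
  qed
  have "n \<le> card (?S \<times> {1..r})"
    using surj_card_le[OF _ sub] by simp
  hence "real n \<le> real (card ?S) * real r"
    by (simp add: card_cartesian_product flip: of_nat_mult)
  also have "\<dots> \<le> real (card ?S) * sqrt n"
    by (intro mult_left_mono) (auto simp: r_def)
  finally have le: "sqrt n * sqrt n \<le> real (card ?S) * sqrt n" by simp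
  show ?thesis
  proof (cases "n = 0")
    case False
    hence "sqrt n > 0" by simp
    thus ?thesis using le by (simp only: mult_le_cancel_right_pos)
  qed simp
qed

text \<open>If \<open>m ^ 4\<close> divides \<open>d ^ 2\<close> then \<open>m ^ 2\<close> divides
  \<open>d\<close>, so squarefree \<open>d\<close> makes \<open>(d ^ 2, 0)\<close> its own minimal
  model. Distinct positive \<open>d\<close> then lie in distinct classes, and the height is
  \<open>4 * d ^ 6\<close>.\<close>

lemma card_squarefree_le_entangled:
  assumes "4 * real n ^ 6 \<le> x"
  shows "card {d \<in> {1..n}. squarefree d} \<le> entangled_class_count x"
proof -
  let ?S = "{d \<in> {1..n}. squarefree d}"
  let ?E = "\<lambda>d :: nat. ((of_nat d) ^ 2, 0) :: weierstrass"
  have minimal: "minimal_pair (int d ^ 2) 0" if d: "squarefree d" for d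
    unfolding minimal_pair_def
  proof
    assume "\<exists>m>1. m ^ 4 dvd int d ^ 2 \<and> m ^ 6 dvd (0 :: int)"
    then obtain m where m: "m > 1" "m ^ 4 dvd int d ^ 2" by auto
    define k where "k = nat m"
    have k: "m = int k" using m by (simp add: k_def)
    have "(int k ^ 2) ^ 2 dvd int d ^ 2" using m by (simp add: k flip: power_mult)
    hence "int k ^ 2 dvd int d" by (simp only: pow_divides_pow_iff)
    hence "k ^ 2 dvd d" by (simp flip: of_nat_power)
    hence "is_unit k" using d by (metis squarefreeD)
    thus False using m k by simp
  qed
  have curve: "?E d \<in> elliptic_curves" if "d \<in> ?S" for d
    using that by (simp add: elliptic_curves_def)
  have model: "minimal_model (?E d) = (int d ^ 2, 0)" if "d \<in> ?S" for d
    using that equiv_ec_iso curve[OF that]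
    by (intro minimal_model_eqI minimal) (auto simp: equiv_def refl_on_def)
  have "inj_on (\<lambda>d. ec_iso `` {?E d}) ?S"
  proof (rule inj_onI)
    fix d e assume de: "d \<in> ?S" "e \<in> ?S" "ec_iso `` {?E d} = ec_iso `` {?E e}"
    have "(?E d, ?E e) \<in> ec_iso"
      using de curve equiv_class_eq_iff[OF equiv_ec_iso] by blast
    hence "minimal_model (?E d) = (int e ^ 2, 0)"
      using de by (intro minimal_model_eqI minimal) auto
    thus "d = e" using model[OF de(1)] by simp
  qed
  hence "card ?S = card ((\<lambda>d. ec_iso `` {?E d}) ` ?S)"
    by (simp add: card_image)
  also have "\<dots> \<le> entangled_class_count x"
    unfolding entangled_class_count_def
  proof (intro card_mono finite_classes_bounded_height image_subsetI quotientI)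
    fix d assume d: "d \<in> ?S"
    have "real_of_int (naive_height (?E d)) = 4 * real d ^ 6"
      by (simp add: naive_height_def model[OF d] model_height_def max_def flip: power_mult)
    also have "\<dots> \<le> 4 * real n ^ 6" using d by (intro mult_left_mono power_mono) auto
    finally show "?E d \<in> {E \<in> elliptic_curves. of_int (naive_height E) \<le> x \<and> has_25_entanglement_Z2 E}"
      using assms d curve[OF d] has_25_entanglement_twist[of "of_nat d"] by simp
  qed
  finally show ?thesis .
qed

lemma power_powr_inverse: "(a ^ 12) powr (1 / 12) = a" if "a \<ge> 0" for a :: real
  using that by (cases "a = 0") (simp_all add: powr_powr flip: powr_numeral)

lemma entangled_class_count_bigomega:
  "(\<lambda>x. real (entangled_class_count x)) \<in> \<Omega>(\<lambda>x. x powr (1 / 12))"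
proof (rule landau_omega.bigI)
  show "eventually (\<lambda>x. norm (real (entangled_class_count x)) \<ge> (1/4) * norm (x powr (1 / 12))) at_top"
    using eventually_ge_at_top[of "4 * 2 ^ 6"]
  proof eventually_elim
    case (elim x)
    define t where "t = (x / 4) powr (1 / 6)"
    have t6: "t ^ 6 = x / 4" using elim by (simp add: t_def powr_power)
    have t0: "t \<ge> 0" by (simp add: t_def)
    \<comment> \<open>The largest \<open>n\<close> with \<open>4 * n ^ 6 \<le> x\<close>. For
      \<open>t \<ge> 2\<close> rounding down loses at most a factor 4, so
      \<open>x \<le> 4 * (4 * n) ^ 6 \<le> (4 * sqrt n) ^ 12\<close>; hence the constant 1/4 and the
      threshold \<open>4 * 2 ^ 6\<close>.\<close>
    define n where "n = nat \<lfloor>t\<rfloor>"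
    have nt: "real n \<le> t" using t0 by (simp add: n_def)
    have "2 \<le> t"
    proof (rule power_le_imp_le_base[of _ 5])
      show "2 ^ Suc 5 \<le> t ^ Suc 5" using elim t6 by simp
    qed (rule t0)
    hence tn: "t \<le> 4 * real n" unfolding n_def by linarith
    have "4 * real n ^ 6 \<le> 4 * t ^ 6" using nt by (intro mult_left_mono power_mono) auto
    hence "4 * real n ^ 6 \<le> x" by (simp add: t6)
    hence "sqrt n \<le> real (entangled_class_count x)"
      using card_squarefree_ge[of n] card_squarefree_le_entangled[of n x] by linarith
    moreover have "x powr (1 / 12) \<le> 4 * sqrt n"
    proof -
      have "x = 4 * t ^ 6" by (simp add: t6)
      also have "\<dots> \<le> 4 * (4 * real n) ^ 6" using tn t0 by (intro mult_left_mono power_mono) auto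
      also have "\<dots> \<le> (4 * sqrt n) ^ 12"
      proof -
        have "(4 * sqrt n) ^ 12 = ((4 * sqrt n)\<^sup>2) ^ 6" by (simp only: flip: power_mult) simp
        also have "\<dots> = 16 ^ 6 * real n ^ 6" by (simp add: power_mult_distrib)
        finally show ?thesis by (simp add: power_mult_distrib)
      qed
      finally have "x powr (1 / 12) \<le> ((4 * sqrt n) ^ 12) powr (1 / 12)"
        using elim by (intro powr_mono2) auto
      also have "\<dots> = 4 * sqrt n"
        by (intro power_powr_inverse) auto
      finally show ?thesis .
    qed
    ultimately show ?case by simp
  qed
qed simp

theorem theorem4p7:
  shows "((\<lambda>x. real (N2 x)) \<sim>[at_top] (\<lambda>x. leading_constant * x powr (1 / 12))) \<and>
    (\<lambda>x. real (entangled_class_count x)) \<in> \<Omega>(\<lambda>x. x powr (1 / 12))"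
  using N2_asymp_equiv entangled_class_count_bigomega by blast

end
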